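(* Let $\kappa>0$, let $\mathcal U\subset\mathbb R^2$ be an exterior region, and let $L=L_{x_0,\theta}$ be a straight line with $x_0\in\mathbb R^2$, $\theta\in\mathbb S^1$. Let $x_1,x_2\in L$ be such that the rays $L^+=L^+_{x_1,\theta}$ and $L^-=L^-_{x_2,\theta}$ satisfy $L^+\subset\mathcal U$ and $L^-\subset\mathcal U$. Let $\Lambda^+\subset L^+$ and $\Lambda^-\subset L^-$ be arbitrary non-empty open intervals. Then every radiation solution $\psi$ of the Helmholtz equation $\Delta\psi+\kappa^2\psi=0$ in $\mathcal U$ is uniquely determined on $L^+\cup L^-$ by $\mathrm{Im}(\psi)$ on $\Lambda^+\cup\Lambda^-$. That is, if $\psi_1,\psi_2$ are two radiation solutions in $\mathcal U$ (for the same $\kappa$) with $\mathrm{Im}(\psi_1)=\mathrm{Im}(\psi_2)$ on $\Lambda^+\cup\Lambda^-$, then $\psi_1=\psi_2$ on $L^+\cup L^-$.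
   Context: An exterior region $\mathcal U$ is an open unbounded connected set in $\mathbb R^2$ consisting of all points outside a closed bounded regular curve $S$. A radiation solution in $\mathcal U$ (for fixed $\kappa>0$) is a complex-valued function $\psi$ of class $C^2$ on $\mathcal U$ satisfying $\Delta\psi(x)+\kappa^2\psi(x)=0$ for $x\in\mathcal U$ and the Sommerfeld radiation condition $\sqrt{|x|}\left(\frac{\partial}{\partial|x|}-i\kappa\right)\psi(x)\to0$ as $|x|\to+\infty$, uniformly in $x/|x|$. For $x_0,x_1,x_2\in\mathbb R^2$ and $\theta\in\mathbb S^1$ (unit circle): $L_{x_0,\theta}=\{x_0+s\theta:\ -\infty<s<+\infty\}$, $L^+_{x_1,\theta}=\{x_1+s\theta:\ 0<s<+\infty\}$, $L^-_{x_2,\theta}=\{x_2-s\theta:\ 0<s<+\infty\}$. *)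

theory Defs
  imports "HOL-Analysis.Analysis"
begin

text \<open>A regular closed curve is taken as the image of a periodic \<open>C\<^sup>1\<close> immersion of the real
  line, so that the tangents match at the point where the curve closes up. Boundedness of the
  image is automatic. The curve is not required to be simple.\<close>

definition closed_regular_curve :: "(real^2) set \<Rightarrow> bool" where
  "closed_regular_curve S \<longleftrightarrow>
     (\<exists>(\<gamma> :: real \<Rightarrow> real^2) T. T > 0 \<and> \<gamma> C1_differentiable_on UNIV \<and>
        (\<forall>t. vector_derivative \<gamma> (at t) \<noteq> 0) \<and> (\<forall>t. \<gamma> (t + T) = \<gamma> t) \<and> S = range \<gamma>)"

text \<open>\<open>outside S\<close> consists of the points off \<open>S\<close> that lie in an unbounded component of the
  complement of \<open>S\<close>; for a simple closed curve this is its exterior in the sense of the Jordan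
  curve theorem. The first three conjuncts follow from the last one.\<close>

definition exterior_region :: "(real^2) set \<Rightarrow> bool" where
  "exterior_region U \<longleftrightarrow> open U \<and> \<not> bounded U \<and> connected U \<and>
     (\<exists>S. closed_regular_curve S \<and> bounded S \<and> U = outside S)"

definition partial_deriv :: "2 \<Rightarrow> (real^2 \<Rightarrow> complex) \<Rightarrow> real^2 \<Rightarrow> complex" where
  "partial_deriv i f x = frechet_derivative f (at x) (axis i 1)"

definition C1_on :: "(real^2) set \<Rightarrow> (real^2 \<Rightarrow> complex) \<Rightarrow> bool" where
  "C1_on U f \<longleftrightarrow> (\<forall>x\<in>U. f differentiable (at x)) \<and> (\<forall>i. continuous_on U (partial_deriv i f))"

definition C2_on :: "(real^2) set \<Rightarrow> (real^2 \<Rightarrow> complex) \<Rightarrow> bool" where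
  "C2_on U f \<longleftrightarrow> C1_on U f \<and> (\<forall>i. C1_on U (partial_deriv i f))"

definition laplacian :: "(real^2 \<Rightarrow> complex) \<Rightarrow> real^2 \<Rightarrow> complex" where
  "laplacian f x = (\<Sum>i\<in>UNIV. partial_deriv i (partial_deriv i f) x)"

text \<open>Polar coordinates \<open>x = r \<omega>\<close> with \<open>r = |x|\<close> and \<open>\<omega> = x/|x|\<close>. The complement of an exterior
  region is bounded, so for large \<open>r\<close> only values of the function in the region matter.\<close>

definition sommerfeld_condition :: "real \<Rightarrow> (real^2 \<Rightarrow> complex) \<Rightarrow> bool" where
  "sommerfeld_condition \<kappa> \<psi> \<longleftrightarrow>
     uniform_limit (sphere 0 1)
       (\<lambda>r \<omega>. of_real (sqrt r) *
          (vector_derivative (\<lambda>s. \<psi> (s *\<^sub>R \<omega>)) (at r) - \<i> * of_real \<kappa> * \<psi> (r *\<^sub>R \<omega>)))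
       (\<lambda>\<omega>. 0) at_top"

definition radiation_solution :: "real \<Rightarrow> (real^2) set \<Rightarrow> (real^2 \<Rightarrow> complex) \<Rightarrow> bool" where
  "radiation_solution \<kappa> U \<psi> \<longleftrightarrow>
     C2_on U \<psi> \<and> (\<forall>x\<in>U. laplacian \<psi> x + of_real (\<kappa>\<^sup>2) * \<psi> x = 0) \<and> sommerfeld_condition \<kappa> \<psi>"

definition straight_line :: "real^2 \<Rightarrow> real^2 \<Rightarrow> (real^2) set" where
  "straight_line x \<theta> = {x + s *\<^sub>R \<theta> | s. True}"

definition ray_plus :: "real^2 \<Rightarrow> real^2 \<Rightarrow> (real^2) set" where
  "ray_plus x \<theta> = {x + s *\<^sub>R \<theta> | s. 0 < s}"

definition ray_minus :: "real^2 \<Rightarrow> real^2 \<Rightarrow> (real^2) set" where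
  "ray_minus x \<theta> = {x - s *\<^sub>R \<theta> | s. 0 < s}"

text \<open>Intervals are open relative to the line and may be bounded or unbounded.\<close>

definition open_interval_of_line :: "real^2 \<Rightarrow> real^2 \<Rightarrow> (real^2) set \<Rightarrow> bool" where
  "open_interval_of_line x \<theta> \<Lambda> \<longleftrightarrow>
     (\<exists>I :: real set. open I \<and> is_interval I \<and> \<Lambda> = (\<lambda>s. x + s *\<^sub>R \<theta>) ` I)"

end

theory Submission imports Defs begin

text \<open>In coordinates with the line as real axis, let \<open>v = \<psi>\<^sub>1 - \<psi>\<^sub>2\<close> and \<open>w z = v z + v (cnj z)\<close>,
  so that \<open>w = 2 v\<close> on the line. On the given interval \<open>Im w\<close> vanishes by assumption and its normal
  derivative vanishes by symmetry; continuing \<open>Im w\<close> by zero across the interval and applying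
  unique continuation shows \<open>Im w = 0\<close> on a connected set containing the ray and a neighbourhood of
  infinity. The real radiation solution \<open>w\<close> then satisfies \<open>w = o(r\<^sup>-\<^sup>1\<^sup>/\<^sup>2)\<close>, and so does \<open>\<partial>\<^sub>r w\<close>,
  hence \<open>w = 0\<close> near infinity by Rellich's lemma and, by unique continuation, on the ray. Unique
  continuation and Rellich's lemma both follow from an energy estimate for the Bessel equation
  satisfied by the angular Fourier coefficients, so no analyticity of solutions is needed.\<close>

subsection \<open>Helmholtz solutions in complex coordinates\<close>

text \<open>The two rays are handled one at a time: the interval on a ray determines the solution on
  that ray, and reversing the direction of the line exchanges the two cases. Two obstacles shape the
  rest. The region need not be symmetric about the line, so \<open>w\<close> is controlled only on
  the intersection of the region with its mirror image; this set may be disconnected, and the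
  argument stays in its component that contains the ray and a neighbourhood of infinity. Moreover,
  the origin from which the Sommerfeld condition measures radii need not lie on the line: in line
  coordinates it is some point \<open>z0\<close>, and the reflected solution radiates about
  \<open>cnj z0\<close>. Two conditions with different centres cannot simply be added. Each is
  therefore first transferred, in the weak form of a limit for every single Fourier coefficient, to
  circles about \<open>0\<close>, a point of the line; there the two limits add up, and this weak
  form is what the energy argument consumes.\<close>

definition lin2 :: "'b::real_vector \<Rightarrow> 'b \<Rightarrow> complex \<Rightarrow> 'b" where
  "lin2 a b h = Re h *\<^sub>R a + Im h *\<^sub>R b"

text \<open>The partial derivatives are arguments, so that they are certified by exhibiting them and
  second derivatives are stated by using the predicate again. The codomain is general because the
  same facts are applied to the complex function \<open>w\<close> and to the real function
  \<open>Im w\<close>.\<close>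

definition C1_partials ::
  "complex set \<Rightarrow> (complex \<Rightarrow> 'b::real_normed_vector) \<Rightarrow> (complex \<Rightarrow> 'b) \<Rightarrow> (complex \<Rightarrow> 'b) \<Rightarrow> bool" where
  "C1_partials W u ux uy \<longleftrightarrow>
     (\<forall>z\<in>W. (u has_derivative lin2 (ux z) (uy z)) (at z)) \<and> continuous_on W ux \<and> continuous_on W uy"

definition helmholtz_on :: "real \<Rightarrow> complex set \<Rightarrow> (complex \<Rightarrow> 'b::real_normed_vector) \<Rightarrow> bool" where
  "helmholtz_on \<kappa> W u \<longleftrightarrow> open W \<and>
     (\<exists>ux uy uxx uxy uyx uyy. C1_partials W u ux uy \<and> C1_partials W ux uxx uxy \<and>
        C1_partials W uy uyx uyy \<and> (\<forall>z\<in>W. uxx z + uyy z + \<kappa>\<^sup>2 *\<^sub>R u z = 0))"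

lemma lin2_unique:
  assumes "lin2 a b = lin2 c d"
  shows "a = c" "b = d"
  using fun_cong[OF assms, of 1] fun_cong[OF assms, of \<i>] by (simp_all add: lin2_def)

lemma C1_partials_derivative:
  "C1_partials W u ux uy \<Longrightarrow> z \<in> W \<Longrightarrow> (u has_derivative lin2 (ux z) (uy z)) (at z)"
  by (simp add: C1_partials_def)

lemma C1_partials_continuous:
  assumes "C1_partials W u ux uy"
  shows "continuous_on W u" "continuous_on W ux" "continuous_on W uy"
  using assms unfolding C1_partials_def
  by (auto intro!: continuous_at_imp_continuous_on has_derivative_continuous)

lemma C1_partials_unique:
  assumes "C1_partials W u ux uy" "z \<in> W" "(u has_derivative lin2 a b) (at z)"
  shows "ux z = a" "uy z = b"
  using lin2_unique[OF has_derivative_unique[OF C1_partials_derivative[OF assms(1,2)] assms(3)]]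
  by auto

lemma C1_partials_subset: "C1_partials W u ux uy \<Longrightarrow> W' \<subseteq> W \<Longrightarrow> C1_partials W' u ux uy"
  unfolding C1_partials_def by (auto intro: continuous_on_subset)

lemma C1_partials_linear:
  assumes "bounded_linear f" "C1_partials W u ux uy"
  shows "C1_partials W (\<lambda>z. f (u z)) (\<lambda>z. f (ux z)) (\<lambda>z. f (uy z))"
proof -
  interpret bounded_linear f by fact
  have "lin2 (f a) (f b) = (\<lambda>h. f (lin2 a b h))" for a b
    by (auto simp: lin2_def add scaleR)
  then show ?thesis
    using assms(2) unfolding C1_partials_def
    by (auto intro!: has_derivative continuous_on)
qed

lemma C1_partials_add:
  assumes "C1_partials W u ux uy" "C1_partials W v vx vy"
  shows "C1_partials W (\<lambda>z. u z + v z) (\<lambda>z. ux z + vx z) (\<lambda>z. uy z + vy z)"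
proof -
  have "lin2 (a + b) (c + d) = (\<lambda>h. lin2 a c h + lin2 b d h)" for a b c d :: 'a
    by (auto simp: lin2_def algebra_simps)
  then show ?thesis
    using assms unfolding C1_partials_def
    by (auto intro!: has_derivative_add continuous_on_add)
qed

lemma C1_partials_cnj:
  assumes "C1_partials W u ux uy"
  shows "C1_partials (cnj ` W) (\<lambda>z. u (cnj z)) (\<lambda>z. ux (cnj z)) (\<lambda>z. - uy (cnj z))"
proof -
  have "((\<lambda>z. u (cnj z)) has_derivative lin2 (ux w) (- uy w)) (at (cnj w))" if "w \<in> W" for w
  proof -
    have "(cnj has_derivative cnj) (at (cnj w))"
      by (auto intro: bounded_linear_imp_has_derivative bounded_linear_cnj)
    moreover have "(u has_derivative lin2 (ux w) (uy w)) (at (cnj (cnj w)))"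
      using C1_partials_derivative[OF assms that] by simp
    ultimately have "((\<lambda>z. u (cnj z)) has_derivative (\<lambda>h. lin2 (ux w) (uy w) (cnj h))) (at (cnj w))"
      by (rule has_derivative_compose)
    then show ?thesis by (simp add: lin2_def[abs_def])
  qed
  moreover have "continuous_on (cnj ` W) (\<lambda>z. f (cnj z))" if "continuous_on W f" for f :: "complex \<Rightarrow> 'a"
    by (rule continuous_on_compose2[OF that]) (auto intro!: continuous_intros)
  ultimately show ?thesis
    using assms unfolding C1_partials_def by (auto intro!: continuous_on_minus)
qed

lemma C1_partials_curve:
  assumes "C1_partials W u ux uy" "\<gamma> t \<in> W" "(\<gamma> has_vector_derivative \<gamma>') (at t)"
  shows "((\<lambda>s. u (\<gamma> s)) has_vector_derivative lin2 (ux (\<gamma> t)) (uy (\<gamma> t)) \<gamma>') (at t)"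
proof -
  have "((\<lambda>s. u (\<gamma> s)) has_derivative (\<lambda>h. lin2 (ux (\<gamma> t)) (uy (\<gamma> t)) (h *\<^sub>R \<gamma>'))) (at t)"
    using assms(3) C1_partials_derivative[OF assms(1,2)] unfolding has_vector_derivative_def
    by (rule has_derivative_compose)
  then show ?thesis
    by (simp add: has_vector_derivative_def lin2_def scaleR_add_right)
qed

lemma helmholtz_on_subset: "helmholtz_on \<kappa> W u \<Longrightarrow> open W' \<Longrightarrow> W' \<subseteq> W \<Longrightarrow> helmholtz_on \<kappa> W' u"
  unfolding helmholtz_on_def by (meson C1_partials_subset subsetD)

lemma helmholtz_on_continuous: "helmholtz_on \<kappa> W u \<Longrightarrow> continuous_on W u"
  unfolding helmholtz_on_def using C1_partials_continuous(1) by blast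

lemma helmholtz_on_linear:
  assumes "bounded_linear f" "helmholtz_on \<kappa> W u"
  shows "helmholtz_on \<kappa> W (\<lambda>z. f (u z))"
proof -
  interpret bounded_linear f by fact
  from assms(2) obtain ux uy uxx uxy uyx uyy where
    *: "open W" "C1_partials W u ux uy" "C1_partials W ux uxx uxy" "C1_partials W uy uyx uyy"
       "\<forall>z\<in>W. uxx z + uyy z + \<kappa>\<^sup>2 *\<^sub>R u z = 0"
    unfolding helmholtz_on_def by blast
  have "f (uxx z) + f (uyy z) + \<kappa>\<^sup>2 *\<^sub>R f (u z) = 0" if "z \<in> W" for z
    using *(5) that by (simp flip: add scaleR)
  then show ?thesis
    unfolding helmholtz_on_def using *(1) *(2-4)[THEN C1_partials_linear[OF assms(1)]]
    by blast
qed

lemma helmholtz_on_add: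
  assumes "helmholtz_on \<kappa> W u" "helmholtz_on \<kappa> W v"
  shows "helmholtz_on \<kappa> W (\<lambda>z. u z + v z)"
proof -
  from assms(1) obtain ux uy uxx uxy uyx uyy where
    *: "open W" "C1_partials W u ux uy" "C1_partials W ux uxx uxy" "C1_partials W uy uyx uyy"
       "\<forall>z\<in>W. uxx z + uyy z + \<kappa>\<^sup>2 *\<^sub>R u z = 0"
    unfolding helmholtz_on_def by blast
  from assms(2) obtain vx vy vxx vxy vyx vyy where
    **: "C1_partials W v vx vy" "C1_partials W vx vxx vxy" "C1_partials W vy vyx vyy"
       "\<forall>z\<in>W. vxx z + vyy z + \<kappa>\<^sup>2 *\<^sub>R v z = 0"
    unfolding helmholtz_on_def by blast
  have "(uxx z + vxx z) + (uyy z + vyy z) + \<kappa>\<^sup>2 *\<^sub>R (u z + v z) = 0" if "z \<in> W" for z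
  proof -
    have "(uxx z + vxx z) + (uyy z + vyy z) + \<kappa>\<^sup>2 *\<^sub>R (u z + v z)
      = (uxx z + uyy z + \<kappa>\<^sup>2 *\<^sub>R u z) + (vxx z + vyy z + \<kappa>\<^sup>2 *\<^sub>R v z)"
      by (simp add: algebra_simps)
    then show ?thesis using *(5) **(4) that by simp
  qed
  with C1_partials_add[OF *(2) **(1)] C1_partials_add[OF *(3) **(2)] C1_partials_add[OF *(4) **(3)] *(1)
  show ?thesis unfolding helmholtz_on_def by blast
qed

text \<open>Reflection flips the sign of each derivative in y, and the second derivative in y is
  flipped twice, so the Laplacian commutes with reflection.\<close>

lemma helmholtz_on_cnj:
  assumes "helmholtz_on \<kappa> W u"
  shows "helmholtz_on \<kappa> (cnj ` W) (\<lambda>z. u (cnj z))"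
proof -
  from assms obtain ux uy uxx uxy uyx uyy where
    *: "open W" "C1_partials W u ux uy" "C1_partials W ux uxx uxy" "C1_partials W uy uyx uyy"
       "\<forall>z\<in>W. uxx z + uyy z + \<kappa>\<^sup>2 *\<^sub>R u z = 0"
    unfolding helmholtz_on_def by blast
  have "cnj ` W = cnj -` W"
    by (auto simp: image_iff) (metis complex_cnj_cnj)
  then have "open (cnj ` W)"
    using *(1) by (auto intro!: open_vimage continuous_intros)
  moreover note C1_partials_cnj[OF *(2)] C1_partials_cnj[OF *(3)]
    C1_partials_linear[OF bounded_linear_minus[OF bounded_linear_ident] C1_partials_cnj[OF *(4)]]
  moreover have "uxx (cnj z) + - (- uyy (cnj z)) + \<kappa>\<^sup>2 *\<^sub>R u (cnj z) = 0" if "z \<in> cnj ` W" for z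
    using *(5) that by auto
  ultimately show ?thesis
    unfolding helmholtz_on_def by blast
qed

subsection \<open>Angular Fourier coefficients\<close>

text \<open>An unnormalised Fourier coefficient on the circle of radius \<open>r\<close> about
  \<open>p\<close>. The weight is an arbitrary function because differentiation in \<open>r\<close>
  replaces \<open>g\<close> by \<open>g cos\<close> and \<open>g sin\<close>.\<close>

definition ang_coeff :: "(real \<Rightarrow> real) \<Rightarrow> (complex \<Rightarrow> 'b::euclidean_space) \<Rightarrow> complex \<Rightarrow> real \<Rightarrow> 'b" where
  "ang_coeff g u p r = integral {0..2*pi} (\<lambda>\<phi>. g \<phi> *\<^sub>R u (p + of_real r * cis \<phi>))"

lemma continuous_on_polar:
  assumes "continuous_on W u" "\<And>\<phi>. p + of_real r * cis \<phi> \<in> W"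
  shows "continuous_on A (\<lambda>\<phi>. u (p + of_real r * cis \<phi>))"
  by (rule continuous_on_compose2[OF assms(1)]) (auto intro!: continuous_intros assms(2))

lemma continuous_on_polar2:
  assumes "continuous_on W u" "\<And>r \<phi>. r \<in> J \<Longrightarrow> p + of_real r * cis \<phi> \<in> W"
  shows "continuous_on (J \<times> A) (\<lambda>x. u (p + of_real (fst x) * cis (snd x)))"
  by (rule continuous_on_compose2[OF assms(1)]) (auto intro!: continuous_intros assms(2))

lemma ang_coeff_integrable:
  assumes "continuous_on {0..2*pi} g" "continuous_on W u" "\<And>\<phi>. p + of_real r * cis \<phi> \<in> W"
  shows "(\<lambda>\<phi>. g \<phi> *\<^sub>R (u (p + of_real r * cis \<phi>) :: 'b::euclidean_space)) integrable_on {0..2*pi}"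
  by (intro integrable_continuous_real continuous_intros assms(1) continuous_on_polar[OF assms(2,3)])

text \<open>Differentiation under the integral sign; the radial derivative of \<open>u\<close> at
  angle \<phi> is \<open>cos \<phi> ux + sin \<phi> uy\<close>.\<close>

lemma ang_coeff_deriv:
  fixes u :: "complex \<Rightarrow> 'b::euclidean_space"
  assumes u: "C1_partials W u ux uy" and J: "open J" "convex J" "r \<in> J"
    and W: "\<And>r \<phi>. r \<in> J \<Longrightarrow> p + of_real r * cis \<phi> \<in> W"
    and g: "continuous_on {0..2*pi} g"
  shows "(ang_coeff g u p has_vector_derivative
           (ang_coeff (\<lambda>\<phi>. g \<phi> * cos \<phi>) ux p r + ang_coeff (\<lambda>\<phi>. g \<phi> * sin \<phi>) uy p r)) (at r)"
proof -
  note c = C1_partials_continuous[OF u]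
  define d where "d r \<phi> = g \<phi> *\<^sub>R lin2 (ux (p + of_real r * cis \<phi>)) (uy (p + of_real r * cis \<phi>)) (cis \<phi>)" for r \<phi>
  have gc: "continuous_on (J \<times> {0..2*pi}) (\<lambda>x. g (snd x))"
    by (rule continuous_on_compose2[OF g]) (auto intro!: continuous_intros)
  have "((\<lambda>r. integral (cbox 0 (2*pi)) (\<lambda>\<phi>. g \<phi> *\<^sub>R u (p + of_real r * cis \<phi>)))
     has_vector_derivative integral (cbox 0 (2*pi)) (d r)) (at r within J)"
  proof (rule leibniz_rule_vector_derivative)
    fix r \<phi> assume "r \<in> J" "\<phi> \<in> cbox 0 (2*pi)"
    have "((\<lambda>s. p + of_real s * cis \<phi>) has_vector_derivative cis \<phi>) (at r)"
      by (auto intro!: derivative_eq_intros)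
    from C1_partials_curve[OF u _ this] W[OF \<open>r \<in> J\<close>]
    have "((\<lambda>s. u (p + of_real s * cis \<phi>)) has_vector_derivative
        lin2 (ux (p + of_real r * cis \<phi>)) (uy (p + of_real r * cis \<phi>)) (cis \<phi>)) (at r)" by blast
    from bounded_linear.has_vector_derivative[OF bounded_linear_scaleR_right this, of "g \<phi>"]
    show "((\<lambda>r. g \<phi> *\<^sub>R u (p + of_real r * cis \<phi>)) has_vector_derivative d r \<phi>) (at r within J)"
      unfolding d_def by (rule has_vector_derivative_at_within)
  next
    fix r assume "r \<in> J"
    then show "(\<lambda>\<phi>. g \<phi> *\<^sub>R u (p + of_real r * cis \<phi>)) integrable_on cbox 0 (2*pi)"
      using ang_coeff_integrable[OF g c(1)] W by auto
  next
    show "continuous_on (J \<times> cbox 0 (2 * pi)) (\<lambda>(x, t). d x t)"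
      unfolding d_def lin2_def split_beta
      using gc continuous_on_polar2[OF c(2) W] continuous_on_polar2[OF c(3) W]
      by (auto intro!: continuous_intros)
  qed (use J in auto)
  moreover have "integral (cbox 0 (2*pi)) (d r) =
      ang_coeff (\<lambda>\<phi>. g \<phi> * cos \<phi>) ux p r + ang_coeff (\<lambda>\<phi>. g \<phi> * sin \<phi>) uy p r"
  proof -
    have 1: "continuous_on {0..2*pi} (\<lambda>\<phi>. g \<phi> * cos \<phi>)" "continuous_on {0..2*pi} (\<lambda>\<phi>. g \<phi> * sin \<phi>)"
      by (intro continuous_intros g)+
    show ?thesis
      unfolding ang_coeff_def d_def lin2_def
      by (subst integral_add[symmetric])
         (auto intro!: ang_coeff_integrable[OF 1(1) c(2)] ang_coeff_integrable[OF 1(2) c(3)] W J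
            simp: scaleR_add_right)
  qed
  ultimately show ?thesis
    using J by (simp add: ang_coeff_def[abs_def] at_within_open[of r J])
qed

text \<open>Separation of variables: since \<open>g\<close> is a periodic eigenfunction of the
  second angular derivative with eigenvalue \<open>- m\<close>, two integrations by parts move the
  angular derivatives from \<open>u\<close> to \<open>g\<close>, and the Helmholtz equation becomes
  the Bessel equation for the coefficient.\<close>

lemma ang_coeff_helmholtz:
  fixes u :: "complex \<Rightarrow> 'b::euclidean_space"
  assumes u: "helmholtz_on \<kappa> W u" and J: "open J" "convex J" "J \<subseteq> {0<..}"
    and W: "\<And>r \<phi>. r \<in> J \<Longrightarrow> p + of_real r * cis \<phi> \<in> W"
    and g: "\<And>\<phi>. (g has_real_derivative g1 \<phi>) (at \<phi>)"
           "\<And>\<phi>. (g1 has_real_derivative - (m * g \<phi>)) (at \<phi>)"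
           "g (2*pi) = g 0" "g1 (2*pi) = g1 0"
  obtains I1 where
    "\<And>r. r \<in> J \<Longrightarrow> (ang_coeff g u p has_vector_derivative I1 r) (at r)"
    "\<And>r. r \<in> J \<Longrightarrow> (I1 has_vector_derivative
        (m / r\<^sup>2 - \<kappa>\<^sup>2) *\<^sub>R ang_coeff g u p r - (1/r) *\<^sub>R I1 r) (at r)"
proof -
  from u obtain ux uy uxx uxy uyx uyy where
    *: "open W" "C1_partials W u ux uy" "C1_partials W ux uxx uxy" "C1_partials W uy uyx uyy"
       "\<forall>z\<in>W. uxx z + uyy z + \<kappa>\<^sup>2 *\<^sub>R u z = 0"
    unfolding helmholtz_on_def by blast
  have gc: "continuous_on A g" "continuous_on A g1" for A
    by (rule DERIV_continuous_on, rule has_field_derivative_at_within, rule g(1))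
       (rule DERIV_continuous_on, rule has_field_derivative_at_within, rule g(2))
  define I1 where "I1 r = ang_coeff (\<lambda>\<phi>. g \<phi> * cos \<phi>) ux p r + ang_coeff (\<lambda>\<phi>. g \<phi> * sin \<phi>) uy p r" for r
  define I2 where "I2 r =
     (ang_coeff (\<lambda>\<phi>. g \<phi> * cos \<phi> * cos \<phi>) uxx p r + ang_coeff (\<lambda>\<phi>. g \<phi> * cos \<phi> * sin \<phi>) uxy p r) +
     (ang_coeff (\<lambda>\<phi>. g \<phi> * sin \<phi> * cos \<phi>) uyx p r + ang_coeff (\<lambda>\<phi>. g \<phi> * sin \<phi> * sin \<phi>) uyy p r)" for r
  have 1: "(ang_coeff g u p has_vector_derivative I1 r) (at r)" if "r \<in> J" for r
    unfolding I1_def using ang_coeff_deriv[OF *(2) J(1,2) that W gc(1)] by blast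
  have 2: "(I1 has_vector_derivative I2 r) (at r)" if "r \<in> J" for r
    unfolding I1_def[abs_def] I2_def
    by (intro has_vector_derivative_add ang_coeff_deriv[OF *(3) J(1,2) that W]
        ang_coeff_deriv[OF *(4) J(1,2) that W] continuous_intros gc)
  have 3: "I2 r = (m / r\<^sup>2 - \<kappa>\<^sup>2) *\<^sub>R ang_coeff g u p r - (1/r) *\<^sub>R I1 r" if "r \<in> J" for r
  proof -
    have "r > 0" using that J by auto
    let ?e = "\<lambda>\<phi>. p + of_real r * cis \<phi>"
    have he: "(?e has_vector_derivative (of_real r * (\<i> * cis \<phi>))) (at \<phi>)" for \<phi>
      by (auto intro!: derivative_eq_intros simp: has_vector_derivative_complex_iff DERIV_minus)
    have hc: "((\<lambda>\<phi>. of_real r * (\<i> * cis \<phi>)) has_vector_derivative (- of_real r * cis \<phi>)) (at \<phi>)" for \<phi>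
      by (auto intro!: derivative_eq_intros simp: has_vector_derivative_complex_iff)
    note du = C1_partials_curve[OF *(2) W[OF that] he] and dux = C1_partials_curve[OF *(3) W[OF that] he]
      and duy = C1_partials_curve[OF *(4) W[OF that] he]
    \<comment> \<open>\<open>F\<close> is \<open>g\<close> times the angular derivative of
      \<open>u\<close>, minus \<open>g1 u\<close>. In its derivative the products of first
      derivatives cancel, leaving \<open>g\<close> times the second angular derivative plus
      \<open>m g u\<close>. As \<open>F\<close> is periodic, this one total derivative performs both
      integrations by parts.\<close>
    define F where "F \<phi> = g \<phi> *\<^sub>R (- (r * sin \<phi>) *\<^sub>R ux (?e \<phi>) + (r * cos \<phi>) *\<^sub>R uy (?e \<phi>)) - g1 \<phi> *\<^sub>R u (?e \<phi>)" for \<phi>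
    define F' where "F' \<phi> = g \<phi> *\<^sub>R
        (r\<^sup>2 *\<^sub>R ((sin \<phi> * sin \<phi>) *\<^sub>R uxx (?e \<phi>) - (sin \<phi> * cos \<phi>) *\<^sub>R uxy (?e \<phi>)
         - (sin \<phi> * cos \<phi>) *\<^sub>R uyx (?e \<phi>) + (cos \<phi> * cos \<phi>) *\<^sub>R uyy (?e \<phi>))
         - (r * cos \<phi>) *\<^sub>R ux (?e \<phi>) - (r * sin \<phi>) *\<^sub>R uy (?e \<phi>) + m *\<^sub>R u (?e \<phi>))" for \<phi>
    have "(F has_vector_derivative F' \<phi>) (at \<phi>)" for \<phi>
      unfolding F_def F'_def
      by (rule derivative_eq_intros g du dux duy refl | simp add: g)+
         (rule euclidean_eqI, simp add: lin2_def inner_simps algebra_simps power2_eq_square)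
    then have "(F' has_integral (F (2*pi) - F 0)) {0..2*pi}"
      by (intro fundamental_theorem_of_calculus) (auto intro: has_vector_derivative_at_within)
    then have int0: "(F' has_integral 0) {0..2*pi}"
      by (simp add: F_def g flip: cis_2pi)
    have hi: "((\<lambda>\<phi>. f \<phi> *\<^sub>R h (?e \<phi>)) has_integral ang_coeff f h p r) {0..2*pi}"
      if "continuous_on {0..2*pi} f" "continuous_on W h" for f h
      unfolding ang_coeff_def
      by (intro integrable_integral ang_coeff_integrable[OF that] W \<open>r \<in> J\<close>)
    note c = C1_partials_continuous[OF *(2)] C1_partials_continuous[OF *(3)] C1_partials_continuous[OF *(4)]
    \<comment> \<open>The integrand is written so that its integral is the Bessel expression. It
      agrees with \<open>F'\<close> pointwise by the polar form of the equation: the second angular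
      derivative equals \<open>- r^2 u_rr - r u_r - \<kappa>^2 r^2 u\<close>.\<close>
    have "((\<lambda>\<phi>. (m - r\<^sup>2 * \<kappa>\<^sup>2) *\<^sub>R (g \<phi> *\<^sub>R u (?e \<phi>))
            - r *\<^sub>R ((g \<phi> * cos \<phi>) *\<^sub>R ux (?e \<phi>) + (g \<phi> * sin \<phi>) *\<^sub>R uy (?e \<phi>))
            - r\<^sup>2 *\<^sub>R (((g \<phi> * cos \<phi> * cos \<phi>) *\<^sub>R uxx (?e \<phi>) + (g \<phi> * cos \<phi> * sin \<phi>) *\<^sub>R uxy (?e \<phi>))
              + ((g \<phi> * sin \<phi> * cos \<phi>) *\<^sub>R uyx (?e \<phi>) + (g \<phi> * sin \<phi> * sin \<phi>) *\<^sub>R uyy (?e \<phi>))))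
        has_integral ((m - r\<^sup>2 * \<kappa>\<^sup>2) *\<^sub>R ang_coeff g u p r - r *\<^sub>R I1 r - r\<^sup>2 *\<^sub>R I2 r)) {0..2*pi}"
      unfolding I1_def I2_def
      by (intro has_integral_diff has_integral_add has_integral_cmul hi c continuous_intros gc)
    also have "(\<lambda>\<phi>. (m - r\<^sup>2 * \<kappa>\<^sup>2) *\<^sub>R (g \<phi> *\<^sub>R u (?e \<phi>))
            - r *\<^sub>R ((g \<phi> * cos \<phi>) *\<^sub>R ux (?e \<phi>) + (g \<phi> * sin \<phi>) *\<^sub>R uy (?e \<phi>))
            - r\<^sup>2 *\<^sub>R (((g \<phi> * cos \<phi> * cos \<phi>) *\<^sub>R uxx (?e \<phi>) + (g \<phi> * cos \<phi> * sin \<phi>) *\<^sub>R uxy (?e \<phi>))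
              + ((g \<phi> * sin \<phi> * cos \<phi>) *\<^sub>R uyx (?e \<phi>) + (g \<phi> * sin \<phi> * sin \<phi>) *\<^sub>R uyy (?e \<phi>)))) = F'"
    proof (rule ext, rule euclidean_eqI, goal_cases)
      case (1 \<phi> b)
      have pde: "uxx (?e \<phi>) \<bullet> b + uyy (?e \<phi>) \<bullet> b + \<kappa>\<^sup>2 * (u (?e \<phi>) \<bullet> b) = 0"
        using arg_cong[OF bspec[OF *(5) W[OF that]], of "\<lambda>v. v \<bullet> b" \<phi>] by (simp add: inner_simps)
      have "(sin \<phi>)\<^sup>2 + (cos \<phi>)\<^sup>2 = 1" by simp
      with pde show ?case
        unfolding F'_def inner_simps by algebra
    qed
    finally have "(m - r\<^sup>2 * \<kappa>\<^sup>2) *\<^sub>R ang_coeff g u p r - r *\<^sub>R I1 r - r\<^sup>2 *\<^sub>R I2 r = 0"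
      using int0 by (rule has_integral_unique)
    then have "r\<^sup>2 *\<^sub>R I2 r = (m - r\<^sup>2 * \<kappa>\<^sup>2) *\<^sub>R ang_coeff g u p r - r *\<^sub>R I1 r" by simp
    then have "(1/r\<^sup>2) *\<^sub>R (r\<^sup>2 *\<^sub>R I2 r) = (1/r\<^sup>2) *\<^sub>R ((m - r\<^sup>2 * \<kappa>\<^sup>2) *\<^sub>R ang_coeff g u p r - r *\<^sub>R I1 r)" by simp
    then show ?thesis using \<open>r > 0\<close>
      by (simp add: scaleR_diff_right diff_divide_distrib power2_eq_square)
  qed
  show thesis
    by (rule that[of I1]) (use 1 2 3 in auto)
qed

text \<open>For a solution \<open>v\<close> of the Bessel equation, \<open>w = \<surd>r v\<close> satisfies
  \<open>w'' + (\<kappa>\<^sup>2 - (m - 1/4)/r\<^sup>2) w = 0\<close>, so the energy \<open>E = |w'|\<^sup>2 + \<kappa>\<^sup>2|w|\<^sup>2\<close> satisfies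
  \<open>|E'| \<le> C E / r\<^sup>2\<close>.\<close>

lemma bessel_energy:
  fixes v v1 :: "real \<Rightarrow> 'b::euclidean_space"
  assumes \<kappa>: "\<kappa> > 0" and J: "J \<subseteq> {0<..}"
    and v: "\<And>r. r \<in> J \<Longrightarrow> (v has_vector_derivative v1 r) (at r)"
    and v1: "\<And>r. r \<in> J \<Longrightarrow> (v1 has_vector_derivative
               (m / r\<^sup>2 - \<kappa>\<^sup>2) *\<^sub>R v r - (1/r) *\<^sub>R v1 r) (at r)"
    and E_def: "\<And>r. E r = (norm (sqrt r *\<^sub>R v1 r + (1 / (2 * sqrt r)) *\<^sub>R v r))\<^sup>2
                + \<kappa>\<^sup>2 * (norm (sqrt r *\<^sub>R v r))\<^sup>2"
  obtains E' where "\<And>r. r \<in> J \<Longrightarrow> (E has_real_derivative E' r) (at r)"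
    "\<And>r. r \<in> J \<Longrightarrow> \<bar>E' r\<bar> \<le> \<bar>m - 1/4\<bar> / \<kappa> / r\<^sup>2 * E r"
proof -
  define w where "w r = sqrt r *\<^sub>R v r" for r
  define w1 where "w1 r = sqrt r *\<^sub>R v1 r + (1 / (2 * sqrt r)) *\<^sub>R v r" for r
  \<comment> \<open>The contributions of \<kappa>^2 to the derivatives of the two summands of
    \<open>E\<close> cancel; only the perturbation of order \<open>1/r^2\<close> survives.\<close>
  define E' where "E' r = (m - 1/4) / r\<^sup>2 * (2 * (w r \<bullet> w1 r))" for r
  have dw: "(w has_vector_derivative w1 r) (at r)" if "r \<in> J" for r
  proof -
    have "r > 0" using that J by auto
    then show ?thesis unfolding w_def[abs_def] w1_def
      by (auto intro!: derivative_eq_intros v that simp: field_simps)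
  qed
  have dw1: "(w1 has_vector_derivative ((m - 1/4)/r\<^sup>2 - \<kappa>\<^sup>2) *\<^sub>R w r) (at r)" if "r \<in> J" for r
  proof -
    have r: "r > 0" using that J by auto
    \<comment> \<open>With \<open>s\<close> in place of the square root the identity to be checked
      is rational.\<close>
    define s where "s = sqrt r"
    have s: "s > 0" "r = s^2" using r by (auto simp: s_def)
    have "(w1 has_vector_derivative
       ((1 / (2 * s)) *\<^sub>R v1 r + s *\<^sub>R ((m / r\<^sup>2 - \<kappa>\<^sup>2) *\<^sub>R v r - (1/r) *\<^sub>R v1 r)
       + (1/(2 * s)) *\<^sub>R v1 r + (- 1 / (4 * s^3)) *\<^sub>R v r)) (at r)"
    proof -
      have 1: "(sqrt has_real_derivative 1 / (2 * s)) (at r)"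
        using r by (auto intro!: derivative_eq_intros simp: s_def field_simps)
      have 2: "((\<lambda>r. 1 / (2 * sqrt r)) has_real_derivative - 1 / (4 * s^3)) (at r)"
        using r s by (auto intro!: derivative_eq_intros simp: s_def[symmetric])
          (simp add: field_simps power2_eq_square power3_eq_cube)
      show ?thesis
        unfolding w1_def[abs_def]
        using has_vector_derivative_add[OF has_vector_derivative_scaleR[OF 1 v1[OF that]]
          has_vector_derivative_scaleR[OF 2 v[OF that]]]
        by (simp add: s_def algebra_simps)
    qed
    also have "(1 / (2 * s)) *\<^sub>R v1 r + s *\<^sub>R ((m / r\<^sup>2 - \<kappa>\<^sup>2) *\<^sub>R v r - (1/r) *\<^sub>R v1 r)
       + (1/(2 * s)) *\<^sub>R v1 r + (- 1 / (4 * s^3)) *\<^sub>R v r = ((m - 1/4)/r\<^sup>2 - \<kappa>\<^sup>2) *\<^sub>R w r"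
      unfolding w_def s_def[symmetric]
      by (rule euclidean_eqI, simp add: inner_simps)
         (use s in \<open>simp add: field_simps power2_eq_square power3_eq_cube\<close>)
    finally show ?thesis .
  qed
  have E: "E = (\<lambda>r. w1 r \<bullet> w1 r + \<kappa>\<^sup>2 * (w r \<bullet> w r))"
    by (rule ext) (simp only: E_def w_def w1_def power2_norm_eq_inner)
  show thesis
  proof (rule that[of E'])
    fix r assume r: "r \<in> J"
    have dot: "((\<lambda>x. f x \<bullet> f x) has_real_derivative 2 * (f r \<bullet> f')) (at r)"
      if "(f has_vector_derivative f') (at r)" for f :: "real \<Rightarrow> 'b" and f'
      using has_derivative_inner[OF that[unfolded has_vector_derivative_def] that[unfolded has_vector_derivative_def]]
      unfolding has_field_derivative_def by (simp add: inner_commute algebra_simps mult_commute_abs)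
    show "(E has_real_derivative E' r) (at r)"
      unfolding E
      by (rule derivative_eq_intros dot dw1 dw r refl)+
         (simp add: E'_def inner_simps inner_commute algebra_simps diff_divide_distrib)
    \<comment> \<open>Expanding the square bounds the cross term \<open>2 \<kappa> |w| |w1|\<close>
      by \<open>E\<close>; this is where the factor \<open>1/\<kappa>\<close> in the estimate comes
      from.\<close>
    have "0 \<le> (norm (w1 r) - \<kappa> * norm (w r))\<^sup>2" by simp
    then have "2 * (\<kappa> * (norm (w r) * norm (w1 r))) \<le> E r"
      by (simp add: E power2_norm_eq_inner[symmetric] power2_diff power_mult_distrib algebra_simps)
    moreover have "\<kappa> * \<bar>w r \<bullet> w1 r\<bar> \<le> \<kappa> * (norm (w r) * norm (w1 r))"
      using \<kappa> Cauchy_Schwarz_ineq2 by (intro mult_left_mono) auto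
    ultimately have "2 * (\<kappa> * \<bar>w r \<bullet> w1 r\<bar>) \<le> E r"
      by linarith
    then have "2 * \<bar>w r \<bullet> w1 r\<bar> \<le> E r / \<kappa>"
      using \<kappa> by (simp add: field_simps)
    then have "\<bar>m - 1/4\<bar> / r\<^sup>2 * (2 * \<bar>w r \<bullet> w1 r\<bar>) \<le> \<bar>m - 1/4\<bar> / r\<^sup>2 * (E r / \<kappa>)"
      by (intro mult_left_mono) auto
    moreover have "\<bar>E' r\<bar> = \<bar>m - 1/4\<bar> / r\<^sup>2 * (2 * \<bar>w r \<bullet> w1 r\<bar>)"
      unfolding E'_def by (subst abs_mult, subst abs_divide, subst abs_mult) simp
    ultimately show "\<bar>E' r\<bar> \<le> \<bar>m - 1/4\<bar> / \<kappa> / r\<^sup>2 * E r"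
      by (simp add: mult_ac)
  qed
qed

text \<open>Gronwall's argument with the integrating factors \<open>exp (- C / r)\<close> and
  \<open>exp (C / r)\<close>: one product increases, the other decreases, so a zero of
  \<open>E\<close> spreads in both directions. Because \<open>C / r^2\<close> is integrable at
  infinity the factors stay bounded there, and a zero limit at infinity spreads inwards just as a
  zero at a finite radius does.\<close>

lemma energy_zero:
  fixes E :: "real \<Rightarrow> real"
  assumes C: "C \<ge> 0" and J: "convex J" "J \<subseteq> {0<..}"
    and E: "\<And>r. r \<in> J \<Longrightarrow> (E has_real_derivative E' r) (at r)"
           "\<And>r. r \<in> J \<Longrightarrow> \<bar>E' r\<bar> \<le> C / r\<^sup>2 * E r" "\<And>r. E r \<ge> 0"
    and zero: "(\<exists>s\<in>J. E s = 0) \<or> (E \<longlongrightarrow> 0) at_top \<and> (\<exists>a. J = {a<..})"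
    and r: "r \<in> J"
  shows "E r = 0"
proof -
  have der: "((\<lambda>r. E r * exp (c / r)) has_real_derivative (E' s - c / s\<^sup>2 * E s) * exp (c / s)) (at s)"
    if "s \<in> J" for s c
  proof -
    have "s \<noteq> 0" using that J by auto
    then show ?thesis
      by (auto intro!: derivative_eq_intros E(1)[OF that] simp: algebra_simps power2_eq_square)
  qed
  have mem: "x \<in> J" if "s \<in> J" "t \<in> J" "s \<le> x" "x \<le> t" for s t x
    using J(1) that mem_is_interval_1_I unfolding is_interval_convex_1[symmetric] by blast
  have up: "E s * exp (- C / s) \<le> E t * exp (- C / t)" if "s \<in> J" "t \<in> J" "s \<le> t" for s t
  proof (rule DERIV_nonneg_imp_nondecreasing[OF that(3)])
    fix x assume "s \<le> x" "x \<le> t"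
    then have x: "x \<in> J" using mem that by blast
    show "\<exists>y. ((\<lambda>x. E x * exp (- C / x)) has_real_derivative y) (at x) \<and> 0 \<le> y"
      using der[OF x, of "- C"] E(2)[OF x] by (intro exI conjI) (auto simp: abs_le_iff)
  qed
  have down: "E s * exp (C / s) \<ge> E t * exp (C / t)" if "s \<in> J" "t \<in> J" "s \<le> t" for s t
  proof (rule DERIV_nonpos_imp_nonincreasing[OF that(3)])
    fix x assume "s \<le> x" "x \<le> t"
    then have x: "x \<in> J" using mem that by blast
    show "\<exists>y. ((\<lambda>x. E x * exp (C / x)) has_real_derivative y) (at x) \<and> y \<le> 0"
      using der[OF x, of "C"] E(2)[OF x] by (intro exI conjI) (auto simp: abs_le_iff mult_le_0_iff)
  qed
  have "E r \<le> 0"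
    using zero
  proof
    assume "\<exists>s\<in>J. E s = 0"
    then obtain s where s: "s \<in> J" "E s = 0" by blast
    show ?thesis
    proof (cases "r \<le> s")
      case True
      from up[OF r s(1) this] s(2) show ?thesis by (simp add: mult_le_0_iff)
    next
      case False
      with down[OF s(1) r] s(2) show ?thesis by (simp add: mult_le_0_iff)
    qed
  next
    assume *: "(E \<longlongrightarrow> 0) at_top \<and> (\<exists>a. J = {a<..})"
    have "\<forall>\<^sub>F t in at_top. E r * exp (- C / r) \<le> E t"
      using eventually_ge_at_top[of r]
    proof eventually_elim
      case (elim t)
      then have "t \<in> J" using r * by auto
      then have "t > 0" using J by auto
      then have "exp (- C / t) \<le> 1" using C by (simp add: divide_nonpos_pos)
      with E(3)[of t] have "E t * exp (- C / t) \<le> E t" by (simp add: mult_left_le)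
      with up[OF r \<open>t \<in> J\<close> elim] show ?case by linarith
    qed
    with * have "E r * exp (- C / r) \<le> 0"
      by (intro tendsto_lowerbound[of E]) auto
    then show ?thesis by (simp add: mult_le_0_iff)
  qed
  with E(3)[of r] show ?thesis by simp
qed

section \<open>Completeness of the trigonometric functions on the circle\<close>

inductive trig_poly :: "(real \<Rightarrow> real) \<Rightarrow> bool" where
  "trig_poly (\<lambda>\<phi>. c * cos (of_int k * \<phi> + d))"
| "trig_poly f \<Longrightarrow> trig_poly g \<Longrightarrow> trig_poly (\<lambda>\<phi>. f \<phi> + g \<phi>)"

text \<open>The free phase makes sine and cosine members of one family, so a single product-to-sum
  formula gives closure under products.\<close>

lemma trig_poly_mult:
  assumes "trig_poly f" "trig_poly g"
  shows "trig_poly (\<lambda>\<phi>. f \<phi> * g \<phi>)"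
  using assms(1)
proof induction
  case (1 c k d)
  show ?case using assms(2)
  proof induction
    case (1 c' k' d')
    have "trig_poly (\<lambda>\<phi>. c * c' / 2 * cos (of_int (k - k') * \<phi> + (d - d'))
             + c * c' / 2 * cos (of_int (k + k') * \<phi> + (d + d')))"
      by (intro trig_poly.intros)
    also have "(\<lambda>\<phi>. c * c' / 2 * cos (of_int (k - k') * \<phi> + (d - d'))
             + c * c' / 2 * cos (of_int (k + k') * \<phi> + (d + d')))
        = (\<lambda>\<phi>. c * cos (of_int k * \<phi> + d) * (c' * cos (of_int k' * \<phi> + d')))"
    proof
      fix \<phi> :: real
      let ?A = "of_int k * \<phi> + d" and ?B = "of_int k' * \<phi> + d'"
      have "of_int (k - k') * \<phi> + (d - d') = ?A - ?B" "of_int (k + k') * \<phi> + (d + d') = ?A + ?B"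
        by (simp_all add: algebra_simps)
      then show "c * c' / 2 * cos (of_int (k - k') * \<phi> + (d - d'))
             + c * c' / 2 * cos (of_int (k + k') * \<phi> + (d + d')) = c * cos ?A * (c' * cos ?B)"
        by (simp only: cos_diff cos_add) (simp add: field_simps)
    qed
    finally show ?case .
  next
    case (2 f g)
    from trig_poly.intros(2)[OF 2(3,4)] show ?case by (simp add: algebra_simps)
  qed
next
  case (2 f g)
  from trig_poly.intros(2)[OF 2(3,4)] show ?case by (simp add: algebra_simps)
qed

text \<open>This connects the Stone-Weierstrass theorem, which supplies polynomials in the plane,
  with the angular modes: a linear functional of \<open>cis \<phi>\<close> is a combination of
  \<open>cos \<phi>\<close> and \<open>sin \<phi>\<close>, and products are handled by
  \<open>trig_poly_mult\<close>.\<close>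

lemma trig_poly_real_polynomial_function:
  fixes p :: "complex \<Rightarrow> real"
  assumes "real_polynomial_function p"
  shows "trig_poly (\<lambda>\<phi>. p (cis \<phi>))"
  using assms
proof induction
  case (linear f)
  interpret bounded_linear f by fact
  have "f (cis \<phi>) = f 1 * cos (of_int 1 * \<phi> + 0) + f \<i> * cos (of_int 1 * \<phi> + - pi/2)" for \<phi>
  proof -
    have "cis \<phi> = cos \<phi> *\<^sub>R 1 + sin \<phi> *\<^sub>R \<i>" by (simp add: complex_eq_iff)
    then have "f (cis \<phi>) = cos \<phi> * f 1 + sin \<phi> * f \<i>" by (simp add: add scaleR)
    moreover have "cos (of_int 1 * \<phi> + - pi/2) = sin \<phi>" by (simp add: cos_diff)
    ultimately show ?thesis by simp
  qed
  then show ?case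
    by (simp only:) (intro trig_poly.intros)
next
  case (const c)
  from trig_poly.intros(1)[of c 0 0] show ?case by simp
next
  case (add f g)
  then show ?case by (intro trig_poly.intros)
next
  case (mult f g)
  then show ?case by (intro trig_poly_mult)
qed

lemma trig_poly_orthogonal:
  fixes h :: "real \<Rightarrow> real"
  assumes h: "continuous_on {0..2*pi} h"
    and 0: "\<And>k d. integral {0..2*pi} (\<lambda>\<phi>. cos (of_int k * \<phi> + d) * h \<phi>) = 0"
    and "trig_poly f"
  shows "((\<lambda>\<phi>. f \<phi> * h \<phi>) has_integral 0) {0..2*pi}"
  using assms(3)
proof induction
  case (1 c k d)
  have "((\<lambda>\<phi>. cos (of_int k * \<phi> + d) * h \<phi>) has_integral
      integral {0..2*pi} (\<lambda>\<phi>. cos (of_int k * \<phi> + d) * h \<phi>)) {0..2*pi}"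
    by (intro integrable_integral integrable_continuous_real continuous_intros h)
  from has_integral_mult_right[OF this, of c] show ?case
    unfolding 0 by (simp add: mult.assoc)
next
  case (2 f g)
  from has_integral_add[OF 2(3,4)] show ?case by (simp add: algebra_simps)
qed

text \<open>If a polynomial \<open>p\<close> is uniformly close to \<open>F\<close> on the circle,
  then \<open>F\<close> is orthogonal to \<open>p\<close>, so the integral of \<open>F^2\<close>
  equals that of \<open>(F - p) F\<close> and is arbitrarily small.\<close>

lemma fourier_unique_real:
  fixes F :: "complex \<Rightarrow> real"
  assumes F: "continuous_on (sphere 0 1) F"
    and 0: "\<And>k d. integral {0..2*pi} (\<lambda>\<phi>. cos (of_int k * \<phi> + d) * F (cis \<phi>)) = 0"
  shows "\<phi> \<in> {0..2*pi} \<Longrightarrow> F (cis \<phi>) = 0"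
proof -
  define h where "h \<phi> = F (cis \<phi>)" for \<phi>
  have h: "continuous_on {0..2*pi} h" unfolding h_def
    by (rule continuous_on_compose2[OF F]) (simp_all add: continuous_on_cis image_subset_iff)
  have "bounded (h ` {0..2*pi})"
    by (intro compact_imp_bounded compact_continuous_image h compact_Icc)
  then obtain M where M: "M > 0" "\<And>\<phi>. \<phi> \<in> {0..2*pi} \<Longrightarrow> \<bar>h \<phi>\<bar> \<le> M"
    by (auto simp: bounded_pos)
  have int: "(\<lambda>\<phi>. h \<phi> * h \<phi>) integrable_on {0..2*pi}"
    by (intro integrable_continuous_real continuous_intros h)
  have "integral {0..2*pi} (\<lambda>\<phi>. h \<phi> * h \<phi>) \<le> 0 + e" if "e > 0" for e
  proof -
    \<comment> \<open>Chosen so that the pointwise bound \<open>e' M\<close>, integrated over an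
      interval of length \<open>2 pi\<close>, gives exactly \<open>e\<close>.\<close>
    define e' where "e' = e / (2 * pi * M)"
    have "e' > 0" using that M by (simp add: e'_def)
    obtain p where p: "real_polynomial_function p" "\<And>x. x \<in> sphere 0 1 \<Longrightarrow> \<bar>F x - p x\<bar> < e'"
      using Stone_Weierstrass_real_polynomial_function[OF _ F \<open>e' > 0\<close>] by auto
    have "((\<lambda>\<phi>. h \<phi> * h \<phi> - p (cis \<phi>) * h \<phi>) has_integral integral {0..2*pi} (\<lambda>\<phi>. h \<phi> * h \<phi>) - 0) {0..2*pi}"
      by (intro has_integral_diff integrable_integral int trig_poly_orthogonal[OF h]
          trig_poly_real_polynomial_function p(1)) (use 0 in \<open>simp add: h_def\<close>)
    moreover have "((\<lambda>\<phi>. e' * M) has_integral (e' * M) * (2 * pi - 0)) {0..2*pi}"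
      using has_integral_const_real[of "e' * M" 0 "2*pi"] by (simp add: mult_ac)
    moreover have "h \<phi> * h \<phi> - p (cis \<phi>) * h \<phi> \<le> e' * M" if "\<phi> \<in> {0..2*pi}" for \<phi>
    proof -
      have "\<bar>h \<phi> - p (cis \<phi>)\<bar> * \<bar>h \<phi>\<bar> \<le> e' * M"
        using p(2)[of "cis \<phi>"] M that \<open>e' > 0\<close> by (intro mult_mono) (auto simp: h_def)
      then have "(h \<phi> - p (cis \<phi>)) * h \<phi> \<le> e' * M"
        using abs_ge_self[of "(h \<phi> - p (cis \<phi>)) * h \<phi>"] unfolding abs_mult by linarith
      then show ?thesis by (simp add: left_diff_distrib)
    qed
    ultimately have "integral {0..2*pi} (\<lambda>\<phi>. h \<phi> * h \<phi>) - 0 \<le> (e' * M) * (2 * pi - 0)"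
      by (rule has_integral_le)
    also have "\<dots> = e" using M by (simp add: e'_def)
    finally show ?thesis by simp
  qed
  then have "integral {0..2*pi} (\<lambda>\<phi>. h \<phi> * h \<phi>) \<le> 0"
    by (rule field_le_epsilon)
  moreover have "integral {0..2*pi} (\<lambda>\<phi>. h \<phi> * h \<phi>) \<ge> 0"
    by (intro integral_nonneg int) auto
  ultimately have "integral {0..2*pi} (\<lambda>\<phi>. h \<phi> * h \<phi>) = 0" by simp
  then have "\<forall>\<phi>\<in>{0..2*pi}. h \<phi> * h \<phi> = 0"
    by (subst (asm) integral_eq_0_iff) (auto intro!: continuous_intros h)
  then show "\<phi> \<in> {0..2*pi} \<Longrightarrow> F (cis \<phi>) = 0" by (auto simp: h_def)
qed

text \<open>Real eigenfunctions with a phase are used instead of complex exponentials because they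
  can multiply values in any Euclidean space; the phases \<open>0\<close> and \<open>- pi/2\<close>
  give the cosine and the sine. The eigenvalue makes \<open>m = k^2\<close> in the Bessel
  equation.\<close>

definition mode :: "int \<Rightarrow> real \<Rightarrow> real \<Rightarrow> real" where
  "mode k d \<phi> = cos (of_int k * \<phi> + d)"

definition mode1 :: "int \<Rightarrow> real \<Rightarrow> real \<Rightarrow> real" where
  "mode1 k d \<phi> = - of_int k * sin (of_int k * \<phi> + d)"

lemma mode_deriv:
  "(mode k d has_real_derivative mode1 k d \<phi>) (at \<phi>)"
  "(mode1 k d has_real_derivative - ((of_int k)\<^sup>2 * mode k d \<phi>)) (at \<phi>)"
  unfolding mode_def[abs_def] mode1_def[abs_def]
  by (auto intro!: derivative_eq_intros simp: power2_eq_square)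

lemma mode_periodic: "mode k d (2 * pi) = mode k d 0" "mode1 k d (2 * pi) = mode1 k d 0"
proof -
  have "of_int k * (2 * pi) + d = d + 2 * pi * of_int k" by simp
  then show "mode k d (2 * pi) = mode k d 0" "mode1 k d (2 * pi) = mode1 k d 0"
    unfolding mode_def mode1_def by (simp_all only: cos_add sin_add cos_int_2pin sin_int_2pin) auto
qed

lemma continuous_on_mode: "continuous_on A (mode k d)"
  unfolding mode_def[abs_def] by (intro continuous_intros)

lemma fourier_unique:
  fixes u :: "complex \<Rightarrow> 'b::euclidean_space"
  assumes u: "continuous_on W u" and W: "sphere p r \<subseteq> W"
    and 0: "\<And>k d. ang_coeff (mode k d) u p r = 0"
    and z: "z \<in> sphere p r" "r > 0"
  shows "u z = 0"
proof (rule euclidean_eqI)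
  fix b :: 'b assume "b \<in> Basis"
  define F where "F w = u (p + of_real r * w) \<bullet> b" for w
  have W': "p + of_real r * cis \<phi> \<in> W" for \<phi>
    using W z by (auto simp: dist_norm norm_mult)
  have F: "continuous_on (sphere 0 1) F" unfolding F_def
    by (intro continuous_intros continuous_on_compose2[OF u])
       (use W z in \<open>auto simp: dist_norm norm_mult\<close>)
  have *: "integral {0..2*pi} (\<lambda>\<phi>. cos (of_int k * \<phi> + d) * F (cis \<phi>)) = 0" for k d
    using arg_cong[OF 0[of k d], of "\<lambda>x. x \<bullet> b"]
      integral_component_eq[OF ang_coeff_integrable[OF continuous_on_mode u W'], of k d b]
    by (simp add: ang_coeff_def F_def mode_def)
  obtain \<phi> where "0 \<le> \<phi>" "\<phi> < 2 * pi" "(z - p) / of_real r = cis \<phi>"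
  proof -
    have "norm ((z - p) / of_real r) = 1" using z by (simp add: norm_divide dist_norm norm_minus_commute)
    then obtain t where "0 \<le> t" "t < 2 * pi" "(z - p) / of_real r = cis t"
      using complex_unimodular_polar[of "(z - p) / of_real r"] by (metis cis.code)
    then show ?thesis using that by blast
  qed
  then have "F ((z - p) / of_real r) = 0"
    using fourier_unique_real[OF F *] by simp
  then show "u z \<bullet> b = 0 \<bullet> b" using z(2) by (simp add: F_def)
qed

subsection \<open>Unique continuation\<close>

text \<open>The common core of unique continuation and of Rellich's lemma. In both the energy of
  every coefficient vanishes somewhere: in the first alternative of \<open>zero\<close> at a finite
  radius, in the second at infinity. \<open>energy_zero\<close> carries this to all radii, and
  completeness of the modes returns from the coefficients to \<open>u\<close>.\<close>

lemma helmholtz_modes_vanish: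
  fixes u :: "complex \<Rightarrow> 'b::euclidean_space"
  assumes \<kappa>: "\<kappa> > 0" and u: "helmholtz_on \<kappa> W u"
    and J: "open J" "convex J" "J \<subseteq> {0<..}"
    and W: "\<And>r. r \<in> J \<Longrightarrow> sphere p r \<subseteq> W"
    and zero: "\<And>k d. (\<exists>S\<subseteq>J. open S \<and> S \<noteq> {} \<and> (\<forall>r\<in>S. ang_coeff (mode k d) u p r = 0)) \<or>
       (\<exists>a. J = {a<..}) \<and> ((\<lambda>r. sqrt r *\<^sub>R ang_coeff (mode k d) u p r) \<longlongrightarrow> 0) at_top \<and>
        ((\<lambda>r. sqrt r *\<^sub>R vector_derivative (ang_coeff (mode k d) u p) (at r)) \<longlongrightarrow> 0) at_top"
    and z: "dist p z \<in> J"
  shows "u z = 0"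
proof -
  have W': "p + of_real r * cis \<phi> \<in> W" if "r \<in> J" for r \<phi>
  proof -
    have "p + of_real r * cis \<phi> \<in> sphere p r"
      using that J(3) by (auto simp: dist_norm norm_mult)
    then show ?thesis using W[OF that] by blast
  qed
  have "ang_coeff (mode k d) u p r = 0" if r: "r \<in> J" for k d r
  proof -
    let ?v = "ang_coeff (mode k d) u p"
    obtain v1 where v1:
      "\<And>r. r \<in> J \<Longrightarrow> (?v has_vector_derivative v1 r) (at r)"
      "\<And>r. r \<in> J \<Longrightarrow> (v1 has_vector_derivative
          ((of_int k)\<^sup>2 / r\<^sup>2 - \<kappa>\<^sup>2) *\<^sub>R ?v r - (1/r) *\<^sub>R v1 r) (at r)"
      by (rule ang_coeff_helmholtz[OF u J W' mode_deriv[of k d] mode_periodic[of k d]];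
          (assumption | (rule that; assumption)))
    define E where "E r = (norm (sqrt r *\<^sub>R v1 r + (1 / (2 * sqrt r)) *\<^sub>R ?v r))\<^sup>2
        + \<kappa>\<^sup>2 * (norm (sqrt r *\<^sub>R ?v r))\<^sup>2" for r
    obtain E' where E': "\<And>r. r \<in> J \<Longrightarrow> (E has_real_derivative E' r) (at r)"
      "\<And>r. r \<in> J \<Longrightarrow> \<bar>E' r\<bar> \<le> \<bar>(of_int k)\<^sup>2 - 1/4\<bar> / \<kappa> / r\<^sup>2 * E r"
      by (rule bessel_energy[OF \<kappa> J(3) v1 E_def]; (assumption | (rule that; assumption)))
    have "E r = 0"
    proof (rule energy_zero[OF _ J(2,3) E' _ _ r])
      show "0 \<le> \<bar>(of_int k)\<^sup>2 - 1/4\<bar> / \<kappa>" using \<kappa> by simp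
      show "0 \<le> E r" for r by (simp add: E_def)
      from zero[of k d] show "(\<exists>s\<in>J. E s = 0) \<or> (E \<longlongrightarrow> 0) at_top \<and> (\<exists>a. J = {a<..})"
      proof
        assume "\<exists>S\<subseteq>J. open S \<and> S \<noteq> {} \<and> (\<forall>r\<in>S. ?v r = 0)"
        \<comment> \<open>\<open>E\<close> involves the coefficient and its derivative. Vanishing on
          an open set of radii annihilates both, which vanishing at one radius would not.\<close>
        then obtain S s where S: "S \<subseteq> J" "open S" "\<And>r. r \<in> S \<Longrightarrow> ?v r = 0" "s \<in> S" by blast
        have "(?v has_vector_derivative 0) (at s)"
          by (rule has_vector_derivative_transform_within_open[OF has_vector_derivative_const S(2,4)])
             (simp add: S(3))
        then have "v1 s = 0"
          using v1(1)[of s] S(1,4) vector_derivative_unique_at by blast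
        then have "E s = 0" using S(3,4) by (simp add: E_def)
        then show ?thesis using S(1,4) by blast
      next
        assume *: "(\<exists>a. J = {a<..}) \<and> ((\<lambda>r. sqrt r *\<^sub>R ?v r) \<longlongrightarrow> 0) at_top \<and>
          ((\<lambda>r. sqrt r *\<^sub>R vector_derivative ?v (at r)) \<longlongrightarrow> 0) at_top"
        then obtain a where a: "J = {a<..}" by blast
        have ev: "\<forall>\<^sub>F r in at_top. r \<in> J" unfolding a using eventually_gt_at_top[of a] by simp
        have 1: "((\<lambda>r. sqrt r *\<^sub>R v1 r) \<longlongrightarrow> 0) at_top"
        proof (rule Lim_transform_eventually)
          show "\<forall>\<^sub>F r in at_top. sqrt r *\<^sub>R vector_derivative ?v (at r) = sqrt r *\<^sub>R v1 r"
            using ev by eventually_elim (simp add: vector_derivative_at[OF v1(1)])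
        qed (use * in blast)
        \<comment> \<open>This term of \<open>E\<close> comes from differentiating
          \<open>sqrt r\<close>; it is \<open>1 / (2 r)\<close> times \<open>sqrt r\<close> times
          the coefficient, hence tends to zero as well.\<close>
        have 2: "((\<lambda>r. (1 / (2 * sqrt r)) *\<^sub>R ?v r) \<longlongrightarrow> 0) at_top"
        proof (rule Lim_transform_eventually)
          have "((\<lambda>r. (1/2 * inverse r) *\<^sub>R (sqrt r *\<^sub>R ?v r)) \<longlongrightarrow> (1/2 * 0) *\<^sub>R 0) at_top"
            using * by (intro tendsto_intros tendsto_inverse_0_at_top filterlim_ident) auto
          then show "((\<lambda>r. (1/2 * inverse r) *\<^sub>R (sqrt r *\<^sub>R ?v r)) \<longlongrightarrow> 0) at_top" by simp
          show "\<forall>\<^sub>F r in at_top. (1/2 * inverse r) *\<^sub>R (sqrt r *\<^sub>R ?v r) = (1 / (2 * sqrt r)) *\<^sub>R ?v r"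
            using eventually_gt_at_top[of 0]
          proof eventually_elim
            case (elim r)
            then have "1/2 * inverse r * sqrt r = 1 / (2 * sqrt r)"
              using sqrt_divide_self_eq[of r] by (simp add: field_simps)
            then show ?case by (simp only: scaleR_scaleR)
          qed
        qed
        have "(E \<longlongrightarrow> (norm (0 + 0 :: 'b))\<^sup>2 + \<kappa>\<^sup>2 * (norm (0 :: 'b))\<^sup>2) at_top"
          unfolding E_def by (intro tendsto_intros 1 2) (use * in blast)
        then show ?thesis using * by simp
      qed
    qed
    then have "\<kappa>\<^sup>2 * (norm (sqrt r *\<^sub>R ?v r))\<^sup>2 = 0"
      unfolding E_def using \<kappa> by (smt (verit) zero_le_mult_iff zero_le_power2)
    then show ?thesis using \<kappa> J(3) r by auto
  qed
  then show ?thesis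
    using fourier_unique[OF helmholtz_on_continuous[OF u] W[OF z], of z] z J(3) by auto
qed

lemma ang_coeff_eq_0:
  assumes "\<And>z. z \<in> sphere p r \<Longrightarrow> u z = 0" "r \<ge> 0"
  shows "ang_coeff g u p r = 0"
proof -
  have "u (p + of_real r * cis \<phi>) = 0" for \<phi>
    using assms by (auto simp: dist_norm norm_mult)
  then show ?thesis by (simp add: ang_coeff_def)
qed

text \<open>The ball on which \<open>u\<close> is known to vanish is concentric with the domain, so
  all coefficients vanish for small radii. The Bessel equation is singular at radius
  \<open>0\<close>, so the centre is treated apart.\<close>

lemma unique_continuation_ball:
  fixes u :: "complex \<Rightarrow> 'b::euclidean_space"
  assumes \<kappa>: "\<kappa> > 0" and u: "helmholtz_on \<kappa> (ball p \<rho>) u"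
    and "e > 0" and 0: "\<And>z. z \<in> ball p e \<Longrightarrow> u z = 0" and z: "z \<in> ball p \<rho>"
  shows "u z = 0"
proof (cases "z = p")
  case True
  then show ?thesis using 0[of p] \<open>e > 0\<close> by simp
next
  case False
  show ?thesis
  proof (rule helmholtz_modes_vanish[OF \<kappa> u, of "{0<..<\<rho>}"])
    show "dist p z \<in> {0<..<\<rho>}" using z False by auto
    fix k d
    have "ang_coeff (mode k d) u p r = 0" if "r \<in> {0<..<min e \<rho>}" for r
      using that by (intro ang_coeff_eq_0 0) auto
    moreover have "{0<..<min e \<rho>} \<noteq> {}"
      using \<open>e > 0\<close> z by (auto simp: not_le intro: le_less_trans[OF zero_le_dist])
    ultimately show "(\<exists>S\<subseteq>{0<..<\<rho>}. open S \<and> S \<noteq> {} \<and> (\<forall>r\<in>S. ang_coeff (mode k d) u p r = 0)) \<or>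
       (\<exists>a. {0<..<\<rho>} = {a<..}) \<and> ((\<lambda>r. sqrt r *\<^sub>R ang_coeff (mode k d) u p r) \<longlongrightarrow> 0) at_top \<and>
        ((\<lambda>r. sqrt r *\<^sub>R vector_derivative (ang_coeff (mode k d) u p) (at r)) \<longlongrightarrow> 0) at_top"
      by (intro disjI1 exI[of _ "{0<..<min e \<rho>}"]) auto
  qed auto
qed

text \<open>The interior of the zero set is open, and the concentric case shows that it is also
  closed relative to \<open>W\<close>; connectedness does the rest.\<close>

lemma unique_continuation:
  fixes u :: "complex \<Rightarrow> 'b::euclidean_space"
  assumes \<kappa>: "\<kappa> > 0" and u: "helmholtz_on \<kappa> W u" and W: "connected W"
    and S: "open S" "S \<noteq> {}" "S \<subseteq> W" "\<And>z. z \<in> S \<Longrightarrow> u z = 0" and z: "z \<in> W"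
  shows "u z = 0"
proof -
  define Z where "Z = interior {z\<in>W. u z = 0}"
  have "open W" using u by (simp add: helmholtz_on_def)
  have Z: "open Z" "Z \<subseteq> W" "\<And>z. z \<in> Z \<Longrightarrow> u z = 0"
    using interior_subset[of "{z\<in>W. u z = 0}"] by (auto simp: Z_def)
  have "S \<subseteq> Z" unfolding Z_def by (rule interior_maximal) (use S in auto)
  have cl: "x \<in> Z" if x: "x \<in> W" "x \<in> closure Z" for x
  proof -
    obtain d where d: "d > 0" "ball x d \<subseteq> W" using \<open>open W\<close> x(1) by (meson openE)
    \<comment> \<open>A distance below \<open>d/2\<close> makes the ball of radius
      \<open>d/2\<close> about \<open>p\<close> contain \<open>x\<close> and yet stay inside
      \<open>ball x d\<close>, so the concentric version applies about \<open>p\<close>.\<close>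
    obtain p where p: "p \<in> Z" "dist p x < d/2"
      using x(2) half_gt_zero[OF d(1)] unfolding closure_approachable by blast
    have sub: "ball p (d/2) \<subseteq> ball x d"
    proof
      fix y assume "y \<in> ball p (d/2)"
      then show "y \<in> ball x d"
        using p(2) dist_triangle[of x y p] by (simp add: dist_commute)
    qed
    obtain e where e: "e > 0" "ball p e \<subseteq> Z" using Z(1) p(1) by (meson openE)
    have "u y = 0" if "y \<in> ball p (d/2)" for y
      by (rule unique_continuation_ball[OF \<kappa> helmholtz_on_subset[OF u] e(1) Z(3) that])
         (use sub d e in auto)
    then have "ball p (d/2) \<subseteq> Z"
      unfolding Z_def by (intro interior_maximal) (use sub d in auto)
    then show ?thesis using p(2) by (auto simp: dist_commute)
  qed
  have "Z = {} \<or> W - closure Z = {}"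
  proof (rule ccontr)
    assume "\<not> ?thesis"
    then have "Z \<noteq> {}" "W - closure Z \<noteq> {}" by auto
    moreover have "open (- closure Z)" by (rule open_Compl[OF closed_closure])
    ultimately show False
      using connectedD[OF W Z(1), of "- closure Z"] Z(2) cl closure_subset[of Z] by auto
  qed
  then show ?thesis using \<open>S \<subseteq> Z\<close> S(2) cl Z(3) z by auto
qed

subsection \<open>Cauchy uniqueness for even solutions\<close>

definition upper_ext :: "(complex \<Rightarrow> 'b::real_normed_vector) \<Rightarrow> complex \<Rightarrow> 'b" where
  "upper_ext f z = (if Im z \<le> 0 then 0 else f z)"

lemma continuous_on_upper_ext:
  assumes "continuous_on W f" "\<And>z. z \<in> W \<Longrightarrow> Im z = 0 \<Longrightarrow> f z = 0"
  shows "continuous_on W (upper_ext f)"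
  unfolding upper_ext_def[abs_def]
  by (rule continuous_on_cases_le)
     (auto intro!: continuous_intros continuous_on_subset[OF assms(1)] simp: assms(2))

text \<open>At a point of the axis \<open>f\<close> and its derivative vanish, so \<open>f\<close>
  is \<open>o(|h|)\<close> there. The extension is dominated by \<open>f\<close> in norm and
  inherits this, hence is differentiable across the axis with derivative zero.\<close>

lemma C1_partials_upper_ext:
  assumes "open W" and f: "C1_partials W f fx fy"
    and 0: "\<And>z. z \<in> W \<Longrightarrow> Im z = 0 \<Longrightarrow> f z = 0 \<and> fx z = 0 \<and> fy z = 0"
  shows "C1_partials W (upper_ext f) (upper_ext fx) (upper_ext fy)"
proof -
  have "(upper_ext f has_derivative lin2 (upper_ext fx z) (upper_ext fy z)) (at z)" if z: "z \<in> W" for z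
  proof (cases "Im z" "0::real" rule: linorder_cases)
    case less
    have "((\<lambda>_. 0) has_derivative lin2 0 (0::'a)) (at z)"
      by (simp add: lin2_def[abs_def])
    then have "(upper_ext f has_derivative lin2 0 0) (at z)"
      by (rule has_derivative_transform_within_open[of _ _ _ _ "{z. Im z < 0}"])
         (use less in \<open>auto simp: upper_ext_def open_halfspace_Im_lt\<close>)
    then show ?thesis using less by (simp add: upper_ext_def)
  next
    case greater
    have "(upper_ext f has_derivative lin2 (fx z) (fy z)) (at z)"
      by (rule has_derivative_transform_within_open[OF C1_partials_derivative[OF f z], of "{z. Im z > 0}"])
         (use greater in \<open>auto simp: upper_ext_def open_halfspace_Im_gt\<close>)
    then show ?thesis using greater by (simp add: upper_ext_def)
  next
    case equal
    note fz = 0[OF z equal]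
    have "(f has_derivative (\<lambda>_. 0)) (at z)"
      using C1_partials_derivative[OF f z] fz by (simp add: lin2_def[abs_def])
    then have *: "\<exists>d>0. \<forall>y. norm (y - z) < d \<longrightarrow> norm (f y) \<le> e * norm (y - z)" if "e > 0" for e
      using that fz by (simp add: has_derivative_at_alt)
    have "norm (upper_ext f y) \<le> norm (f y)" for y by (simp add: upper_ext_def)
    then have "\<exists>d>0. \<forall>y. norm (y - z) < d \<longrightarrow> norm (upper_ext f y) \<le> e * norm (y - z)" if "e > 0" for e
      using *[OF that] by (meson order_trans)
    then have "(upper_ext f has_derivative (\<lambda>_. 0)) (at z)"
      using equal by (simp add: has_derivative_at_alt upper_ext_def)
    then show ?thesis using equal by (simp add: upper_ext_def lin2_def[abs_def])
  qed
  moreover have "continuous_on W (upper_ext fx)" "continuous_on W (upper_ext fy)"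
    using C1_partials_continuous[OF f] 0 by (auto intro!: continuous_on_upper_ext)
  ultimately show ?thesis by (simp add: C1_partials_def)
qed

lemma C1_partials_zero_on_axis:
  assumes "open W" and f: "C1_partials W f fx fy"
    and 0: "\<And>z. z \<in> W \<Longrightarrow> Im z = 0 \<Longrightarrow> f z = 0"
    and z: "z \<in> W" "Im z = 0"
  shows "fx z = 0"
proof -
  have d: "((\<lambda>t. z + of_real t) has_vector_derivative 1) (at 0)"
    by (auto intro!: derivative_eq_intros)
  have 1: "((\<lambda>t. f (z + of_real t)) has_vector_derivative lin2 (fx z) (fy z) 1) (at 0)"
    using C1_partials_curve[OF f _ d] z by simp
  have "open ((\<lambda>t. z + of_real t) -` W)"
    by (intro open_vimage \<open>open W\<close> continuous_intros)
  then have "((\<lambda>t. f (z + of_real t)) has_vector_derivative 0) (at 0)"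
    by (rule has_vector_derivative_transform_within_open[OF has_vector_derivative_const])
       (use z 0 in auto)
  from vector_derivative_unique_at[OF 1 this] show ?thesis by (simp add: lin2_def)
qed

lemma C1_partials_even:
  assumes "open W" and f: "C1_partials W f fx fy"
    and W: "cnj ` W = W" and even: "\<And>z. z \<in> W \<Longrightarrow> f (cnj z) = f z"
    and z: "z \<in> W"
  shows "fx (cnj z) = fx z" "fy (cnj z) = - fy z"
proof -
  have "((\<lambda>z. f (cnj z)) has_derivative lin2 (fx (cnj z)) (- fy (cnj z))) (at z)"
    using C1_partials_derivative[OF C1_partials_cnj[OF f], unfolded W, OF z] .
  then have "(f has_derivative lin2 (fx (cnj z)) (- fy (cnj z))) (at z)"
    by (rule has_derivative_transform_within_open[OF _ \<open>open W\<close> z]) (rule even)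
  from C1_partials_unique[OF f z this]
  show "fx (cnj z) = fx z" "fy (cnj z) = - fy z" by auto
qed

text \<open>Evenness makes \<open>uy\<close> odd, so both Cauchy data vanish on the axis. For the
  extension by zero to be again a solution of class C^2, all second derivatives must vanish there
  too. Those of \<open>uxx\<close> and \<open>uyx\<close> type are tangential derivatives of
  functions that are zero on the axis, and \<open>uxy\<close> is odd because \<open>ux\<close> is
  even.\<close>

lemma even_cauchy_unique:
  fixes u :: "complex \<Rightarrow> 'b::euclidean_space"
  assumes \<kappa>: "\<kappa> > 0" and u: "helmholtz_on \<kappa> (ball p \<rho>) u" and p: "Im p = 0"
    and even: "\<And>z. z \<in> ball p \<rho> \<Longrightarrow> u (cnj z) = u z"
    and axis: "\<And>z. z \<in> ball p \<rho> \<Longrightarrow> Im z = 0 \<Longrightarrow> u z = 0"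
    and z: "z \<in> ball p \<rho>"
  shows "u z = 0"
proof -
  let ?W = "ball p \<rho>"
  from u obtain ux uy uxx uxy uyx uyy where
    *: "C1_partials ?W u ux uy" "C1_partials ?W ux uxx uxy" "C1_partials ?W uy uyx uyy"
       "\<forall>z\<in>?W. uxx z + uyy z + \<kappa>\<^sup>2 *\<^sub>R u z = 0"
    unfolding helmholtz_on_def by blast
  have cp: "cnj p = p" using p by (simp add: complex_eq_iff)
  have mem: "cnj z \<in> ?W \<longleftrightarrow> z \<in> ?W" for z
  proof -
    have "dist p (cnj z) = cmod (cnj (p - z))" by (simp add: dist_norm cp)
    also have "\<dots> = dist p z" by (simp only: complex_mod_cnj dist_norm)
    finally show ?thesis by simp
  qed
  have W: "cnj ` ?W = ?W"
    using mem by (auto simp: image_iff simp del: mem_ball) (metis complex_cnj_cnj)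
  have neg0: "a = 0" if "a = - a" for a :: 'b
  proof -
    have "2 *\<^sub>R a = a + a" by (simp add: scaleR_2)
    also have "\<dots> = 0" using that by (metis add.right_inverse)
    finally show ?thesis by simp
  qed
  have cr: "cnj z = z" if "Im z = 0" for z using that by (simp add: complex_eq_iff)
  have ax: "ux z = 0 \<and> uy z = 0 \<and> uxx z = 0 \<and> uxy z = 0 \<and> uyx z = 0 \<and> uyy z = 0"
    if z: "z \<in> ?W" "Im z = 0" for z
  proof -
    have x: "ux z = 0" if "z \<in> ?W" "Im z = 0" for z
      using C1_partials_zero_on_axis[OF open_ball *(1) axis] that by blast
    have y: "uy z = 0" if "z \<in> ?W" "Im z = 0" for z
      using C1_partials_even(2)[OF open_ball *(1) W even that(1)] cr[OF that(2)] neg0 by simp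
    have xx: "uxx z = 0" using C1_partials_zero_on_axis[OF open_ball *(2) x] z by blast
    have yx: "uyx z = 0" using C1_partials_zero_on_axis[OF open_ball *(3) y] z by blast
    have xy: "uxy z = 0"
      using C1_partials_even(2)[OF open_ball *(2) W _ z(1)] cr[OF z(2)] neg0
        C1_partials_even(1)[OF open_ball *(1) W even] by simp
    \<comment> \<open>The purely normal second derivative is not reached by symmetry or by
      differentiating along the axis; the equation itself supplies it.\<close>
    have "uyy z = 0" using bspec[OF *(4) z(1)] axis[OF z] xx by simp
    then show ?thesis using x y xx yx xy z by blast
  qed
  have "helmholtz_on \<kappa> ?W (upper_ext u)"
    unfolding helmholtz_on_def
  proof (intro conjI exI)
    show "C1_partials ?W (upper_ext u) (upper_ext ux) (upper_ext uy)"
      by (rule C1_partials_upper_ext[OF open_ball *(1)]) (use ax axis in blast)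
    show "C1_partials ?W (upper_ext ux) (upper_ext uxx) (upper_ext uxy)"
      by (rule C1_partials_upper_ext[OF open_ball *(2)]) (use ax axis in blast)
    show "C1_partials ?W (upper_ext uy) (upper_ext uyx) (upper_ext uyy)"
      by (rule C1_partials_upper_ext[OF open_ball *(3)]) (use ax axis in blast)
    show "\<forall>z\<in>?W. upper_ext uxx z + upper_ext uyy z + \<kappa>\<^sup>2 *\<^sub>R upper_ext u z = 0"
      using *(4) by (simp add: upper_ext_def)
  qed simp
  moreover have "open (?W \<inter> {z. Im z < 0})" by (intro open_Int open_ball open_halfspace_Im_lt)
  moreover have "?W \<inter> {z. Im z < 0} \<noteq> {}"
  proof -
    have "\<rho> > 0" using z by (simp add: le_less_trans[OF zero_le_dist])
    then have "p - \<i> * of_real (\<rho>/2) \<in> ?W \<inter> {z. Im z < 0}"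
      using p by (auto simp: dist_norm norm_mult)
    then show ?thesis by blast
  qed
  ultimately have up: "upper_ext u z = 0" if "z \<in> ?W" for z
    by (rule unique_continuation[OF \<kappa> _ connected_ball]) (use that in \<open>auto simp: upper_ext_def\<close>)
  show ?thesis
  proof (cases "Im z" "0::real" rule: linorder_cases)
    case less
    then have "upper_ext u (cnj z) = u z" using even z by (simp add: upper_ext_def)
    then show ?thesis using up[of "cnj z"] mem z by simp
  next
    case greater
    then show ?thesis using up[OF z] by (simp add: upper_ext_def)
  qed (use axis z in blast)
qed

subsection \<open>The radiation condition about a shifted origin\<close>

text \<open>The derivative applied to \<open>sgn (z - z0)\<close> is the radial derivative about
  \<open>z0\<close>. The centre is a parameter because the origin of the plane has some position
  \<open>z0\<close> in line coordinates, in general off the real axis.\<close>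

definition radiating :: "real \<Rightarrow> complex \<Rightarrow> (complex \<Rightarrow> complex) \<Rightarrow> bool" where
  "radiating \<kappa> z0 v \<longleftrightarrow> (\<forall>e>0. \<exists>R. \<forall>z. cmod (z - z0) > R \<longrightarrow>
     sqrt (cmod (z - z0)) *
       cmod (frechet_derivative v (at z) (sgn (z - z0)) - \<i> * of_real \<kappa> * v z) \<le> e)"

text \<open>Along a ray from \<open>z0\<close> the product of \<open>v\<close> with
  \<open>cis (- \<kappa> s)\<close> has derivative of modulus \<open>|v' - \<i> \<kappa> v|\<close>,
  which the radiation condition bounds by 1. So the modulus of \<open>v\<close> grows at most
  linearly from its maximum on a starting circle.\<close>

lemma radiating_growth:
  assumes v: "C1_partials {z. cmod z > R0} v vx vy" and rad: "radiating \<kappa> z0 v"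
  obtains M \<rho> where "M \<ge> 0" "\<And>z. cmod (z - z0) \<ge> \<rho> \<Longrightarrow> cmod (v z) \<le> M + cmod (z - z0)"
proof -
  let ?W = "{z. cmod z > R0}"
  obtain R where R: "\<And>z. cmod (z - z0) > R \<Longrightarrow> sqrt (cmod (z - z0)) *
       cmod (frechet_derivative v (at z) (sgn (z - z0)) - \<i> * of_real \<kappa> * v z) \<le> 1"
    using rad[unfolded radiating_def, rule_format, OF zero_less_one] by blast
  define \<rho> where "\<rho> = max (R + 1) (max 1 (R0 + cmod z0 + 1))"
  have \<rho>: "\<rho> > R" "\<rho> \<ge> 1" "\<rho> > R0 + cmod z0" unfolding \<rho>_def by auto
  have inW: "z \<in> ?W" if "cmod (z - z0) \<ge> \<rho>" for z
    using that \<rho>(3) norm_triangle_ineq4[of z z0] by simp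
  have D: "cmod (lin2 (vx z) (vy z) (sgn (z - z0)) - \<i> * of_real \<kappa> * v z) \<le> 1"
    if z: "cmod (z - z0) \<ge> \<rho>" for z
  proof -
    have "frechet_derivative v (at z) = lin2 (vx z) (vy z)"
      using frechet_derivative_at[OF C1_partials_derivative[OF v inW[OF z]]] by simp
    moreover have "1 \<le> sqrt (cmod (z - z0))" using z \<rho>(2) by simp
    ultimately show ?thesis
      using R[of z] z \<rho>(1) mult_right_mono[of 1 "sqrt (cmod (z - z0))"
          "cmod (lin2 (vx z) (vy z) (sgn (z - z0)) - \<i> * of_real \<kappa> * v z)"] by simp
  qed
  have "compact (v ` sphere z0 \<rho>)"
    by (intro compact_continuous_image compact_sphere continuous_on_subset[OF C1_partials_continuous(1)[OF v]])
       (use inW in \<open>auto simp: dist_norm norm_minus_commute\<close>)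
  then obtain M where M: "M > 0" "\<And>z. z \<in> sphere z0 \<rho> \<Longrightarrow> cmod (v z) \<le> M"
    using compact_imp_bounded bounded_pos by (metis imageI)
  have "cmod (v z) \<le> M + cmod (z - z0)" if z: "cmod (z - z0) \<ge> \<rho>" for z
  proof -
    define t where "t = cmod (z - z0)"
    define e where "e = sgn (z - z0)"
    have t: "t \<ge> \<rho>" "t > 0" "z = z0 + of_real t * e" "cmod e = 1"
    proof -
      show "t \<ge> \<rho>" "t > 0" using z \<rho>(2) by (auto simp: t_def)
      then have nz: "z \<noteq> z0" by (auto simp: t_def)
      then show "z = z0 + of_real t * e" by (simp add: t_def e_def sgn_eq)
      show "cmod e = 1" using nz by (simp add: e_def norm_sgn)
    qed
    define \<gamma> where "\<gamma> s = z0 + of_real s * e" for s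
    have \<gamma>: "cmod (\<gamma> s - z0) = s" "sgn (\<gamma> s - z0) = e" if "s \<ge> \<rho>" for s
      using that \<rho>(2) t(4) by (auto simp: \<gamma>_def norm_mult sgn_mult sgn_eq)
    define F where "F s = cis (- \<kappa> * s) * v (\<gamma> s)" for s
    define F' where "F' s = cis (- \<kappa> * s) * (lin2 (vx (\<gamma> s)) (vy (\<gamma> s)) e - \<i> * of_real \<kappa> * v (\<gamma> s))" for s
    have F: "(F has_vector_derivative F' s) (at s)" if "s \<ge> \<rho>" for s
    proof -
      have "(\<gamma> has_vector_derivative e) (at s)"
        unfolding \<gamma>_def[abs_def] by (auto intro!: derivative_eq_intros)
      note 1 = C1_partials_curve[OF v inW this, of, OF eq_refl[OF \<gamma>(1)[symmetric, OF that], THEN order_trans[OF that]]]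
      have 2: "((\<lambda>s. cis (- \<kappa> * s)) has_vector_derivative (- \<i> * of_real \<kappa> * cis (- \<kappa> * s))) (at s)"
        by (auto intro!: derivative_eq_intros simp: has_vector_derivative_complex_iff)
      show ?thesis unfolding F_def[abs_def] F'_def
        using has_vector_derivative_mult[OF 2 1] by (simp add: algebra_simps)
    qed
    have "cmod (F t - F \<rho>) \<le> t - \<rho>"
    proof (cases "t = \<rho>")
      case False
      have "\<exists>x\<in>{\<rho><..<t}. norm (F t - F \<rho>) \<le> norm ((t - \<rho>) *\<^sub>R F' x)"
      proof (rule mvt_general)
        show "\<rho> < t" using False t(1) by simp
        show "continuous_on {\<rho>..t} F"
          by (rule continuous_on_vector_derivative[OF has_vector_derivative_at_within[OF F]]) auto
        show "(F has_derivative (\<lambda>h. h *\<^sub>R F' x)) (at x)" if "\<rho> < x" for x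
          using F[of x] that by (simp add: has_vector_derivative_def)
      qed
      then obtain x where x: "x \<in> {\<rho><..<t}" "norm (F t - F \<rho>) \<le> norm ((t - \<rho>) *\<^sub>R F' x)" by blast
      have "cmod (F' x) \<le> 1"
        using D[of "\<gamma> x"] \<gamma>[of x] x(1) by (simp add: F'_def norm_mult)
      then have "(t - \<rho>) * cmod (F' x) \<le> t - \<rho>" using t(1) by (simp add: mult_left_le)
      with x(2) t(1) show ?thesis by simp
    qed auto
    moreover have "cmod (F t) = cmod (v z)" using t(3) by (simp add: F_def \<gamma>_def norm_mult)
    moreover have "cmod (F \<rho>) \<le> M"
      using M(2)[of "\<gamma> \<rho>"] \<gamma>(1)[of \<rho>] by (simp add: F_def norm_mult dist_norm norm_minus_commute)
    ultimately have "cmod (v z) \<le> M + (t - \<rho>)"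
      using norm_triangle_ineq2[of "F t" "F \<rho>"] by linarith
    then show ?thesis using \<rho>(2) by (simp add: t_def)
  qed
  then show thesis using M(1) by (intro that[of M \<rho>]) auto
qed

text \<open>The radiation condition is imposed along rays from \<open>z\<^sub>0\<close>, while the circles are centred at
  \<open>0\<close>. The two radial directions differ by a tangential derivative, which is moved to the
  trigonometric weight by integration by parts; then the crude linear bound on \<open>v\<close> suffices.\<close>

lemma weak_radiation:
  fixes k :: int and d :: real
  assumes v: "C1_partials {z. cmod z > R0} v vx vy" and rad: "radiating \<kappa> z0 v" and "\<kappa> > 0"
  defines "I \<equiv> ang_coeff (mode k d) v 0"
  shows "((\<lambda>r. sqrt r *\<^sub>R (vector_derivative I (at r) - \<i> * of_real \<kappa> * I r)) \<longlongrightarrow> 0) at_top"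
proof -
  let ?W = "{z. cmod z > R0}"
  let ?g = "mode k d" and ?g1 = "mode1 k d"
  obtain M \<rho>0 where M: "M \<ge> 0" "\<And>z. cmod (z - z0) \<ge> \<rho>0 \<Longrightarrow> cmod (v z) \<le> M + cmod (z - z0)"
    using radiating_growth[OF v rad] by blast
  define c where "c = cmod z0"
  define K where "K = \<bar>of_int k :: real\<bar>"
  have c: "c \<ge> 0" and K: "K \<ge> 0" by (auto simp: c_def K_def)
  have g: "\<bar>?g \<phi>\<bar> \<le> 1" "\<bar>?g1 \<phi>\<bar> \<le> K" for \<phi>
    unfolding mode_def mode1_def K_def abs_mult abs_minus_cancel
    by (rule abs_cos_le_one, rule mult_left_le[OF abs_sin_le_one abs_ge_zero])
  \<comment> \<open>The first summand bounds the error of replacing the distance to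
    \<open>z0\<close> by its component along the radius from \<open>0\<close>; the second bounds the
    weight \<open>h1\<close> left by the integration by parts. Both carry \<open>M + 2\<close>
    because the linear growth gives \<open>|v| \<le> (M + 2) r\<close> on the circle.\<close>
  define B where "B = 4 * \<kappa> * c\<^sup>2 * (M + 2) + (2 * (K + 1) * c + 4 * c\<^sup>2) * (M + 2)"
  \<comment> \<open>The condition with \<open>2 * c\<close> makes \<open>r - q\<close> at least
    \<open>r/2\<close>; the others put the circle into the domain and beyond the thresholds \<rho>0
    and \<open>R\<close>, which are measured from \<open>z0\<close>.\<close>
  have main: "cmod (sqrt r *\<^sub>R (vector_derivative I (at r) - \<i> * of_real \<kappa> * I r))
      \<le> 2 * pi * (B / sqrt r + 4 * e)"
    if r: "r \<ge> 1" "r \<ge> 2 * c + 1" "r > R0" "r - c > \<rho>0" "r - c > R" and "e > 0"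
      and R: "\<And>z. cmod (z - z0) > R \<Longrightarrow> sqrt (cmod (z - z0)) *
       cmod (frechet_derivative v (at z) (sgn (z - z0)) - \<i> * of_real \<kappa> * v z) \<le> e" for r R e
  proof -
    let ?z = "\<lambda>\<phi>. of_real r * cis \<phi>"
    \<comment> \<open>\<open>q\<close> and \<open>q1\<close> are the components of \<open>z0\<close>
      along the radial direction \<open>cis \<phi>\<close> and the tangential direction
      \<open>\<i> cis \<phi>\<close>; \<open>dr\<close> and \<open>dt\<close> are the derivatives of
      \<open>v\<close> in these two directions.\<close>
    define q where "q \<phi> = Re z0 * cos \<phi> + Im z0 * sin \<phi>" for \<phi>
    define q1 where "q1 \<phi> = Im z0 * cos \<phi> - Re z0 * sin \<phi>" for \<phi>
    define dr where "dr \<phi> = lin2 (vx (?z \<phi>)) (vy (?z \<phi>)) (cis \<phi>)" for \<phi>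
    define dt where "dt \<phi> = lin2 (vx (?z \<phi>)) (vy (?z \<phi>)) (\<i> * cis \<phi>)" for \<phi>
    \<comment> \<open>Solving the derivative towards \<open>z0\<close> for \<open>dr\<close> leaves
      the tangential term \<open>q1 / (r - q) dt\<close>. As the angular derivative of
      \<open>v\<close> on the circle is \<open>r dt\<close>, the weight to be integrated by parts is
      this coefficient times the mode, divided by \<open>r\<close>; \<open>h1\<close> is its
      derivative.\<close>
    define h where "h \<phi> = ?g \<phi> * q1 \<phi> / (r * (r - q \<phi>))" for \<phi>
    define h1 where "h1 \<phi> = (?g1 \<phi> * q1 \<phi> - ?g \<phi> * q \<phi>) / (r * (r - q \<phi>))
        + ?g \<phi> * (q1 \<phi>)\<^sup>2 / (r * (r - q \<phi>)\<^sup>2)" for \<phi>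
    have zW: "?z \<phi> \<in> ?W" for \<phi> using r by (simp add: norm_mult)
    have qq: "(q \<phi>)\<^sup>2 + (q1 \<phi>)\<^sup>2 = c\<^sup>2" for \<phi>
    proof -
      have "(q \<phi>)\<^sup>2 + (q1 \<phi>)\<^sup>2 = ((Re z0)\<^sup>2 + (Im z0)\<^sup>2) * ((sin \<phi>)\<^sup>2 + (cos \<phi>)\<^sup>2)"
        unfolding q_def q1_def by algebra
      then show ?thesis by (simp add: c_def cmod_power2)
    qed
    have q: "\<bar>q \<phi>\<bar> \<le> c" "\<bar>q1 \<phi>\<bar> \<le> c" for \<phi>
    proof -
      have "\<bar>q \<phi>\<bar>\<^sup>2 \<le> c\<^sup>2" "\<bar>q1 \<phi>\<bar>\<^sup>2 \<le> c\<^sup>2"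
        unfolding power2_abs qq[of \<phi>, symmetric] by simp_all
      then show "\<bar>q \<phi>\<bar> \<le> c" "\<bar>q1 \<phi>\<bar> \<le> c" using c by (auto intro: power2_le_imp_le)
    qed
    have rq: "r / 2 \<le> r - q \<phi>" "r - q \<phi> \<le> 2 * r" "r - q \<phi> > 0" for \<phi>
      using q(1)[of \<phi>] r by (auto simp: abs_le_iff)
    have dec: "?z \<phi> - z0 = of_real (r - q \<phi>) * cis \<phi> - of_real (q1 \<phi>) * (\<i> * cis \<phi>)" for \<phi>
    proof -
      have "(sin \<phi>)\<^sup>2 + (cos \<phi>)\<^sup>2 = 1" by simp
      then have "Re z0 = q \<phi> * cos \<phi> - q1 \<phi> * sin \<phi>" "Im z0 = q \<phi> * sin \<phi> + q1 \<phi> * cos \<phi>"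
        unfolding q_def q1_def by algebra+
      then show ?thesis by (simp add: complex_eq_iff algebra_simps)
    qed
    have q': "(q has_real_derivative q1 \<phi>) (at \<phi>)" "(q1 has_real_derivative - q \<phi>) (at \<phi>)" for \<phi>
      unfolding q_def[abs_def] q1_def[abs_def] by (auto intro!: derivative_eq_intros)
    have h': "(h has_real_derivative h1 \<phi>) (at \<phi>)" for \<phi>
    proof -
      have "((\<lambda>\<phi>. ?g \<phi> * q1 \<phi>) has_real_derivative (?g1 \<phi> * q1 \<phi> - ?g \<phi> * q \<phi>)) (at \<phi>)"
        by (rule derivative_eq_intros mode_deriv q' refl)+ simp
      moreover have "((\<lambda>\<phi>. r * (r - q \<phi>)) has_real_derivative r * (- q1 \<phi>)) (at \<phi>)"
        by (rule derivative_eq_intros q' refl)+ simp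
      moreover have "r * (r - q \<phi>) \<noteq> 0" using r rq(3)[of \<phi>] by simp
      ultimately have "(h has_real_derivative ((?g1 \<phi> * q1 \<phi> - ?g \<phi> * q \<phi>) * (r * (r - q \<phi>))
          - ?g \<phi> * q1 \<phi> * (r * (- q1 \<phi>))) / (r * (r - q \<phi>) * (r * (r - q \<phi>)))) (at \<phi>)"
        unfolding h_def[abs_def] by (rule DERIV_divide)
      moreover have "(a * (r * w) - b * x * (r * - x)) / (r * w * (r * w)) = a / (r * w) + b * x\<^sup>2 / (r * w\<^sup>2)"
        if "w > 0" for a b x w :: real
        using that r by (simp add: field_simps power2_eq_square)
      ultimately show ?thesis unfolding h1_def using rq(3)[of \<phi>] by simp
    qed
    define \<Phi> where "\<Phi> \<phi> = h \<phi> *\<^sub>R v (?z \<phi>)" for \<phi>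
    have "(\<Phi> has_vector_derivative (h \<phi> *\<^sub>R (of_real r * dt \<phi>) + h1 \<phi> *\<^sub>R v (?z \<phi>))) (at \<phi>)" for \<phi>
    proof -
      have "(?z has_vector_derivative (of_real r * (\<i> * cis \<phi>))) (at \<phi>)"
        by (auto intro!: derivative_eq_intros simp: has_vector_derivative_complex_iff)
      from has_vector_derivative_scaleR[OF h' C1_partials_curve[OF v zW this]]
      show ?thesis unfolding \<Phi>_def[abs_def] dt_def
        by (simp add: lin2_def algebra_simps scaleR_conv_of_real)
    qed
    then have "((\<lambda>\<phi>. h \<phi> *\<^sub>R (of_real r * dt \<phi>) + h1 \<phi> *\<^sub>R v (?z \<phi>)) has_integral \<Phi> (2*pi) - \<Phi> 0) {0..2*pi}"
      by (intro fundamental_theorem_of_calculus) (auto intro: has_vector_derivative_at_within)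
    moreover have "\<Phi> (2*pi) = \<Phi> 0"
      by (simp add: \<Phi>_def h_def q_def q1_def mode_periodic)
    ultimately have int0: "((\<lambda>\<phi>. h \<phi> *\<^sub>R (of_real r * dt \<phi>) + h1 \<phi> *\<^sub>R v (?z \<phi>)) has_integral 0) {0..2*pi}"
      by simp
    note cont = C1_partials_continuous[OF v]
    have hi: "((\<lambda>\<phi>. f \<phi> *\<^sub>R u (?z \<phi>)) has_integral ang_coeff f u 0 r) {0..2*pi}"
      if "continuous_on {0..2*pi} f" "continuous_on ?W u" for f and u :: "complex \<Rightarrow> complex"
      using integrable_integral[OF ang_coeff_integrable[OF that, of 0 r]] zW
      by (simp add: ang_coeff_def)
    have "vector_derivative I (at r) =
        ang_coeff (\<lambda>\<phi>. ?g \<phi> * cos \<phi>) vx 0 r + ang_coeff (\<lambda>\<phi>. ?g \<phi> * sin \<phi>) vy 0 r"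
      unfolding I_def
      by (rule vector_derivative_at, rule ang_coeff_deriv[OF v, of "{max 0 R0<..}"])
         (use r in \<open>auto simp: norm_mult intro!: continuous_on_mode\<close>)
    moreover have "((\<lambda>\<phi>. (?g \<phi> * cos \<phi>) *\<^sub>R vx (?z \<phi>) + (?g \<phi> * sin \<phi>) *\<^sub>R vy (?z \<phi>)
         - \<i> * of_real \<kappa> * (?g \<phi> *\<^sub>R v (?z \<phi>)))
       has_integral (ang_coeff (\<lambda>\<phi>. ?g \<phi> * cos \<phi>) vx 0 r + ang_coeff (\<lambda>\<phi>. ?g \<phi> * sin \<phi>) vy 0 r)
         - \<i> * of_real \<kappa> * I r) {0..2*pi}"
      unfolding I_def
      by (intro has_integral_diff has_integral_add has_integral_mult_right hi cont
          continuous_intros continuous_on_mode)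
    ultimately have "((\<lambda>\<phi>. ?g \<phi> *\<^sub>R (dr \<phi> - \<i> * of_real \<kappa> * v (?z \<phi>))) has_integral
        vector_derivative I (at r) - \<i> * of_real \<kappa> * I r) {0..2*pi}"
      by (simp add: dr_def lin2_def algebra_simps)
    \<comment> \<open>Subtracting the total derivative leaves the integral unchanged, but now
      \<open>dt\<close>, for which there is no bound, cancels pointwise in the integrand.\<close>
    from has_integral_diff[OF this int0]
    have int: "((\<lambda>\<phi>. ?g \<phi> *\<^sub>R (dr \<phi> - \<i> * of_real \<kappa> * v (?z \<phi>)) -
         (h \<phi> *\<^sub>R (of_real r * dt \<phi>) + h1 \<phi> *\<^sub>R v (?z \<phi>))) has_integral
        vector_derivative I (at r) - \<i> * of_real \<kappa> * I r) {0..2*pi}" by simp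
    have bound: "cmod (?g \<phi> *\<^sub>R (dr \<phi> - \<i> * of_real \<kappa> * v (?z \<phi>)) -
         (h \<phi> *\<^sub>R (of_real r * dt \<phi>) + h1 \<phi> *\<^sub>R v (?z \<phi>))) \<le> B / r + 4 * e / sqrt r" for \<phi>
    proof -
      define \<rho> where "\<rho> = cmod (?z \<phi> - z0)"
      define \<delta> where "\<delta> = lin2 (vx (?z \<phi>)) (vy (?z \<phi>)) (sgn (?z \<phi> - z0)) - \<i> * of_real \<kappa> * v (?z \<phi>)"
      have \<rho>: "\<rho> \<ge> r - c" "\<rho> \<le> 2 * r"
        using norm_triangle_ineq2[of "?z \<phi>" z0] norm_triangle_ineq4[of "?z \<phi>" z0] r
        by (auto simp: \<rho>_def c_def norm_mult)
      have \<rho>pos: "\<rho> > 0" using \<rho> r c by linarith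
      have vb: "cmod (v (?z \<phi>)) \<le> (M + 2) * r"
      proof -
        have "cmod (v (?z \<phi>)) \<le> M + \<rho>" using M(2)[of "?z \<phi>"] \<rho> r by (simp add: \<rho>_def)
        also have "\<dots> \<le> M * r + 2 * r" using \<rho> mult_left_mono[OF r(1) M(1)] by simp
        finally show ?thesis by (simp add: algebra_simps)
      qed
      have fd: "frechet_derivative v (at (?z \<phi>)) = lin2 (vx (?z \<phi>)) (vy (?z \<phi>))"
        using frechet_derivative_at[OF C1_partials_derivative[OF v zW]] by simp
      have \<delta>b: "\<rho> * cmod \<delta> \<le> 2 * e * sqrt r"
      proof -
        have "sqrt \<rho> * cmod \<delta> \<le> e" using R[of "?z \<phi>"] \<rho>(1) r by (simp add: \<rho>_def \<delta>_def fd)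
        then have "sqrt \<rho> * (sqrt \<rho> * cmod \<delta>) \<le> sqrt \<rho> * e" using \<rho>pos by (intro mult_left_mono) auto
        moreover have "sqrt \<rho> \<le> sqrt (4 * r)" using \<rho> r by simp
        then have "sqrt \<rho> * e \<le> (2 * sqrt r) * e" using \<open>e > 0\<close> by (simp add: real_sqrt_mult)
        moreover have "\<rho> * cmod \<delta> = sqrt \<rho> * (sqrt \<rho> * cmod \<delta>)"
          using \<rho>pos by (simp flip: mult.assoc)
        ultimately have "\<rho> * cmod \<delta> \<le> (2 * sqrt r) * e" by linarith
        then show ?thesis by (simp add: mult_ac)
      qed
      have \<rho>2: "\<rho>\<^sup>2 = (r - q \<phi>)\<^sup>2 + (q1 \<phi>)\<^sup>2"
      proof -
        have "?z \<phi> - z0 = cis \<phi> * Complex (r - q \<phi>) (- q1 \<phi>)"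
          unfolding dec by (simp add: complex_eq_iff algebra_simps)
        then have "\<rho> = cmod (Complex (r - q \<phi>) (- q1 \<phi>))"
          unfolding \<rho>_def by (simp only: norm_mult norm_cis mult_1)
        then show ?thesis by (simp add: cmod_power2)
      qed
      \<comment> \<open>The difference of the squares of \<rho> and \<open>r - q\<close> is
        \<open>q1^2\<close>, at most \<open>c^2\<close>, while their sum is at least
        \<open>r/2\<close>.\<close>
      have diff: "\<bar>\<rho> - (r - q \<phi>)\<bar> \<le> 2 * c\<^sup>2 / r"
      proof -
        have "(\<rho> - (r - q \<phi>)) * (\<rho> + (r - q \<phi>)) = (q1 \<phi>)\<^sup>2"
          using \<rho>2 by (simp add: algebra_simps power2_eq_square)
        moreover have "(q1 \<phi>)\<^sup>2 \<le> c\<^sup>2" using qq[of \<phi>] by (smt (verit) zero_le_power2)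
        ultimately have "\<bar>\<rho> - (r - q \<phi>)\<bar> * (\<rho> + (r - q \<phi>)) \<le> c\<^sup>2"
          using \<rho>pos rq(3)[of \<phi>] by (metis abs_mult abs_of_pos abs_power2 add_pos_pos)
        moreover have "\<bar>\<rho> - (r - q \<phi>)\<bar> * (r/2) \<le> \<bar>\<rho> - (r - q \<phi>)\<bar> * (\<rho> + (r - q \<phi>))"
          using \<rho>pos rq(1)[of \<phi>] by (intro mult_left_mono) auto
        ultimately show ?thesis using r by (simp add: field_simps)
      qed
      have \<rho>D: "of_real \<rho> * lin2 (vx (?z \<phi>)) (vy (?z \<phi>)) (sgn (?z \<phi> - z0))
          = of_real (r - q \<phi>) * dr \<phi> - of_real (q1 \<phi>) * dt \<phi>"
      proof -
        have L: "linear (lin2 (vx (?z \<phi>)) (vy (?z \<phi>)))"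
          by (rule linearI) (simp_all add: lin2_def algebra_simps)
        have "of_real \<rho> * lin2 (vx (?z \<phi>)) (vy (?z \<phi>)) (sgn (?z \<phi> - z0))
          = lin2 (vx (?z \<phi>)) (vy (?z \<phi>)) (\<rho> *\<^sub>R sgn (?z \<phi> - z0))"
          unfolding linear_scale[OF L] by (rule scaleR_conv_of_real[symmetric])
        also have "\<rho> *\<^sub>R sgn (?z \<phi> - z0) = (r - q \<phi>) *\<^sub>R cis \<phi> - q1 \<phi> *\<^sub>R (\<i> * cis \<phi>)"
        proof -
          have "\<rho> *\<^sub>R sgn (?z \<phi> - z0) = ?z \<phi> - z0"
            unfolding sgn_div_norm \<rho>_def[symmetric] scaleR_scaleR using \<rho>pos by simp
          also have "\<dots> = (r - q \<phi>) *\<^sub>R cis \<phi> - q1 \<phi> *\<^sub>R (\<i> * cis \<phi>)"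
            unfolding dec by (simp add: scaleR_conv_of_real)
          finally show ?thesis .
        qed
        also have "lin2 (vx (?z \<phi>)) (vy (?z \<phi>)) \<dots> = of_real (r - q \<phi>) * dr \<phi> - of_real (q1 \<phi>) * dt \<phi>"
          unfolding linear_diff[OF L] linear_scale[OF L] dr_def dt_def by (simp add: scaleR_conv_of_real)
        finally show ?thesis .
      qed
      \<comment> \<open>\<open>G\<close> is what remains of
        \<open>(r - q) (dr - \<i> \<kappa> v)\<close> once the tangential term is removed: the
        mismatch between \<rho> and \<open>r - q\<close> multiplied by \<open>v\<close>, and the
        radiation defect \<delta>.\<close>
      define G where "G = \<i> * of_real \<kappa> * of_real (\<rho> - (r - q \<phi>)) * v (?z \<phi>) + of_real \<rho> * \<delta>"
      have "of_real (r - q \<phi>) * (dr \<phi> - \<i> * of_real \<kappa> * v (?z \<phi>)) - of_real (q1 \<phi>) * dt \<phi> = G"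
        using \<rho>D unfolding G_def \<delta>_def by (simp add: algebra_simps)
      then have dr_eq: "dr \<phi> - \<i> * of_real \<kappa> * v (?z \<phi>) = (G + of_real (q1 \<phi>) * dt \<phi>) / of_real (r - q \<phi>)"
        using rq(3)[of \<phi>] by (simp add: field_simps)
      have "h \<phi> *\<^sub>R (of_real r * dt \<phi>) = ?g \<phi> *\<^sub>R (of_real (q1 \<phi>) * dt \<phi> / of_real (r - q \<phi>))"
        using r by (simp add: h_def scaleR_conv_of_real)
      then have "?g \<phi> *\<^sub>R (dr \<phi> - \<i> * of_real \<kappa> * v (?z \<phi>)) -
         (h \<phi> *\<^sub>R (of_real r * dt \<phi>) + h1 \<phi> *\<^sub>R v (?z \<phi>))
        = ?g \<phi> *\<^sub>R (G / of_real (r - q \<phi>)) - h1 \<phi> *\<^sub>R v (?z \<phi>)"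
        unfolding dr_eq add_divide_distrib scaleR_add_right by simp
      moreover have "cmod (?g \<phi> *\<^sub>R (G / of_real (r - q \<phi>))) \<le> 4 * \<kappa> * c\<^sup>2 * (M + 2) / r + 4 * e / sqrt r"
      proof -
        have "cmod G \<le> \<kappa> * \<bar>\<rho> - (r - q \<phi>)\<bar> * cmod (v (?z \<phi>)) + \<rho> * cmod \<delta>"
          unfolding G_def using \<open>\<kappa> > 0\<close> \<rho>pos
          by (intro order_trans[OF norm_triangle_ineq]) (simp add: norm_mult del: of_real_diff)
        also have "\<dots> \<le> \<kappa> * (2 * c\<^sup>2 / r) * ((M + 2) * r) + 2 * e * sqrt r"
          using \<open>\<kappa> > 0\<close> r by (intro add_mono \<delta>b mult_mono diff vb) auto
        also have "\<dots> = 2 * \<kappa> * c\<^sup>2 * (M + 2) + 2 * e * sqrt r" using r by (simp add: field_simps)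
        finally have "cmod G \<le> 2 * \<kappa> * c\<^sup>2 * (M + 2) + 2 * e * sqrt r" .
        then have "cmod G / (r - q \<phi>) \<le> (2 * \<kappa> * c\<^sup>2 * (M + 2) + 2 * e * sqrt r) / (r / 2)"
          using rq(1)[of \<phi>] r by (intro frac_le order_trans[OF norm_ge_zero]) auto
        also have "\<dots> = 4 * \<kappa> * c\<^sup>2 * (M + 2) / r + 4 * e * (sqrt r / r)"
          using r by (simp add: field_simps)
        also have "sqrt r / r = 1 / sqrt r" using r sqrt_divide_self_eq[of r] by (simp add: inverse_eq_divide)
        finally have "cmod (G / of_real (r - q \<phi>)) \<le> 4 * \<kappa> * c\<^sup>2 * (M + 2) / r + 4 * e / sqrt r"
          using rq(3)[of \<phi>] by (simp add: norm_divide del: of_real_diff)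
        moreover have "\<bar>?g \<phi>\<bar> * cmod (G / of_real (r - q \<phi>)) \<le> 1 * cmod (G / of_real (r - q \<phi>))"
          by (intro mult_right_mono g) simp
        ultimately show ?thesis by simp
      qed
      moreover have "cmod (h1 \<phi> *\<^sub>R v (?z \<phi>)) \<le> (2 * (K + 1) * c + 4 * c\<^sup>2) * (M + 2) / r"
      proof -
        have "\<bar>h1 \<phi>\<bar> \<le> \<bar>?g1 \<phi> * q1 \<phi> - ?g \<phi> * q \<phi>\<bar> / (r * (r - q \<phi>)) + \<bar>?g \<phi> * (q1 \<phi>)\<^sup>2\<bar> / (r * (r - q \<phi>)\<^sup>2)"
          unfolding h1_def using r rq(3)[of \<phi>]
          by (intro order_trans[OF abs_triangle_ineq]) (simp add: abs_mult)
        also have "\<dots> \<le> (K * c + 1 * c) / (r * (r/2)) + (1 * c\<^sup>2) / (r * (r/2)\<^sup>2)"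
        proof (intro add_mono frac_le)
          show "\<bar>?g1 \<phi> * q1 \<phi> - ?g \<phi> * q \<phi>\<bar> \<le> K * c + 1 * c"
          proof -
            have "\<bar>?g1 \<phi> * q1 \<phi>\<bar> \<le> K * c"
              unfolding abs_mult using K by (intro mult_mono g q) auto
            moreover have "\<bar>?g \<phi> * q \<phi>\<bar> \<le> 1 * c"
              unfolding abs_mult by (intro mult_mono g q) auto
            ultimately show ?thesis
              using abs_triangle_ineq4[of "?g1 \<phi> * q1 \<phi>" "?g \<phi> * q \<phi>"] by linarith
          qed
          show "\<bar>?g \<phi> * (q1 \<phi>)\<^sup>2\<bar> \<le> 1 * c\<^sup>2"
          proof -
            have "(q1 \<phi>)\<^sup>2 \<le> c\<^sup>2" unfolding qq[of \<phi>, symmetric] by simp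
            then show ?thesis
              unfolding abs_mult by (intro mult_mono g) auto
          qed
        qed (use r rq[of \<phi>] c K in \<open>auto intro!: mult_mono power_mono\<close>)
        also have "\<dots> = (2 * (K + 1) * c) / r\<^sup>2 + 4 * c\<^sup>2 / r\<^sup>2 * (1 / r)"
          using r by (simp add: field_simps power2_eq_square)
        also have "\<dots> \<le> (2 * (K + 1) * c) / r\<^sup>2 + 4 * c\<^sup>2 / r\<^sup>2 * 1"
          using r by (intro add_left_mono mult_left_mono) auto
        also have "\<dots> = (2 * (K + 1) * c + 4 * c\<^sup>2) / r\<^sup>2" by (simp add: add_divide_distrib)
        finally have "\<bar>h1 \<phi>\<bar> * cmod (v (?z \<phi>)) \<le> (2 * (K + 1) * c + 4 * c\<^sup>2) / r\<^sup>2 * ((M + 2) * r)"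
          using vb K c by (intro mult_mono) auto
        then show ?thesis using r by (simp add: power2_eq_square mult_ac)
      qed
      moreover have "B / r = 4 * \<kappa> * c\<^sup>2 * (M + 2) / r + (2 * (K + 1) * c + 4 * c\<^sup>2) * (M + 2) / r"
        unfolding B_def by (rule add_divide_distrib)
      ultimately show ?thesis
        using norm_triangle_ineq4[of "?g \<phi> *\<^sub>R (G / of_real (r - q \<phi>))" "h1 \<phi> *\<^sub>R v (?z \<phi>)"]
        by (simp only:)
    qed
    have "cmod (vector_derivative I (at r) - \<i> * of_real \<kappa> * I r) \<le> (B / r + 4 * e / sqrt r) * (2 * pi)"
      using has_integral_bound_real[OF order_trans[OF norm_ge_zero bound] finite.emptyI int bound]
      by simp
    then have "sqrt r * cmod (vector_derivative I (at r) - \<i> * of_real \<kappa> * I r)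
        \<le> sqrt r * ((B / r + 4 * e / sqrt r) * (2 * pi))"
      using r by (intro mult_left_mono) auto
    also have "\<dots> = 2 * pi * (B * (sqrt r / r) + 4 * e * (sqrt r / sqrt r))"
      by (simp add: algebra_simps)
    also have "sqrt r / sqrt r = 1" using r by simp
    also have "sqrt r / r = 1 / sqrt r" using r sqrt_divide_self_eq[of r] by (simp add: inverse_eq_divide)
    finally show ?thesis using r by simp
  qed
  show ?thesis
  proof (rule tendstoI)
    fix e :: real assume "e > 0"
    \<comment> \<open>Then \<open>2 pi * 4 e'\<close> is \<open>e/2\<close>, and the other half of
      \<open>e\<close> is left for the term with \<open>B\<close>.\<close>
    define e' where "e' = e / (16 * pi)"
    have e': "e' > 0" using \<open>e > 0\<close> by (simp add: e'_def)
    then obtain R where R: "\<And>z. cmod (z - z0) > R \<Longrightarrow> sqrt (cmod (z - z0)) *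
       cmod (frechet_derivative v (at z) (sgn (z - z0)) - \<i> * of_real \<kappa> * v z) \<le> e'"
      using rad[unfolded radiating_def, rule_format, OF e'] by blast
    have "((\<lambda>r. B * inverse (sqrt r)) \<longlongrightarrow> B * 0) at_top"
      by (intro tendsto_intros tendsto_inverse_0_at_top sqrt_at_top)
    then have "\<forall>\<^sub>F r in at_top. B * inverse (sqrt r) < e / (4 * pi)"
      using \<open>e > 0\<close> by (intro order_tendstoD(2)) auto
    then show "\<forall>\<^sub>F r in at_top. dist (sqrt r *\<^sub>R (vector_derivative I (at r) - \<i> * of_real \<kappa> * I r)) 0 < e"
      using eventually_gt_at_top[of "max 1 (max (2 * c + 1) (max R0 (max (\<rho>0 + c) (R + c))))"]
    proof eventually_elim
      case (elim r)
      have "cmod (sqrt r *\<^sub>R (vector_derivative I (at r) - \<i> * of_real \<kappa> * I r)) \<le> 2 * pi * (B / sqrt r + 4 * e')"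
        by (rule main[OF _ _ _ _ _ e' R]) (use elim in auto)
      also have "\<dots> < 2 * pi * (e / (4 * pi) + 4 * e')"
        using elim(1) by (intro mult_strict_left_mono) (auto simp: inverse_eq_divide)
      also have "\<dots> = e" by (simp add: e'_def field_simps)
      finally show ?case by simp
    qed
  qed
qed

lemma radiating_cnj:
  assumes v: "C1_partials {z. cmod z > R0} v vx vy" and rad: "radiating \<kappa> z0 v"
  shows "radiating \<kappa> (cnj z0) (\<lambda>z. v (cnj z))"
  unfolding radiating_def
proof (intro allI impI)
  fix e :: real assume "e > 0"
  then obtain R where R: "\<And>z. cmod (z - z0) > R \<Longrightarrow> sqrt (cmod (z - z0)) *
     cmod (frechet_derivative v (at z) (sgn (z - z0)) - \<i> * of_real \<kappa> * v z) \<le> e"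
    using rad[unfolded radiating_def, rule_format, of e] by blast
  show "\<exists>R. \<forall>z. cmod (z - cnj z0) > R \<longrightarrow> sqrt (cmod (z - cnj z0)) *
     cmod (frechet_derivative (\<lambda>z. v (cnj z)) (at z) (sgn (z - cnj z0)) - \<i> * of_real \<kappa> * v (cnj z)) \<le> e"
  proof (intro exI[of _ "max R (R0 + cmod z0)"] allI impI)
    fix z assume z: "cmod (z - cnj z0) > max R (R0 + cmod z0)"
    have eq: "cnj z - z0 = cnj (z - cnj z0)" by simp
    then have m: "cmod (cnj z - z0) = cmod (z - cnj z0)" by (metis complex_mod_cnj)
    have s: "sgn (cnj z - z0) = cnj (sgn (z - cnj z0))"
      unfolding sgn_eq m by simp
    have "cmod z > R0" using norm_triangle_ineq4[of z "cnj z0"] z by simp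
    then have D: "(v has_derivative lin2 (vx (cnj z)) (vy (cnj z))) (at (cnj z))"
      by (intro C1_partials_derivative[OF v]) simp
    have "((\<lambda>z. v (cnj z)) has_derivative (\<lambda>h. lin2 (vx (cnj z)) (vy (cnj z)) (cnj h))) (at z)"
      by (rule has_derivative_compose[OF bounded_linear_imp_has_derivative[OF bounded_linear_cnj] D])
    from frechet_derivative_at[OF this] frechet_derivative_at[OF D]
    have "frechet_derivative (\<lambda>z. v (cnj z)) (at z) (sgn (z - cnj z0))
      = frechet_derivative v (at (cnj z)) (sgn (cnj z - z0))" unfolding s by metis
    then show "sqrt (cmod (z - cnj z0)) * cmod (frechet_derivative (\<lambda>z. v (cnj z)) (at z)
        (sgn (z - cnj z0)) - \<i> * of_real \<kappa> * v (cnj z)) \<le> e"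
      using R[of "cnj z"] z m by simp
  qed
qed

lemma ang_coeff_add:
  assumes "continuous_on {0..2*pi} g" "continuous_on W u" "continuous_on W v"
    "\<And>\<phi>. p + of_real r * cis \<phi> \<in> W"
  shows "ang_coeff g (\<lambda>z. u z + v z) p r = ang_coeff g u p r + ang_coeff g v p r"
  unfolding ang_coeff_def scaleR_add_right
  by (intro integral_add ang_coeff_integrable[OF assms(1,2,4)] ang_coeff_integrable[OF assms(1,3,4)])

text \<open>The summands radiate about \<open>z0\<close> and about \<open>cnj z0\<close>. Their
  coefficients on circles about \<open>0\<close> satisfy the same limit, so they can be
  added.\<close>

lemma weak_radiation_even:
  fixes k :: int and d :: real
  assumes v: "C1_partials {z. cmod z > R0} v vx vy" and rad: "radiating \<kappa> z0 v" and "\<kappa> > 0"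
  defines "I \<equiv> ang_coeff (mode k d) (\<lambda>z. v z + v (cnj z)) 0"
  shows "((\<lambda>r. sqrt r *\<^sub>R (vector_derivative I (at r) - \<i> * of_real \<kappa> * I r)) \<longlongrightarrow> 0) at_top"
proof -
  let ?W = "{z. cmod z > R0}" and ?I1 = "ang_coeff (mode k d) v 0"
    and ?I2 = "ang_coeff (mode k d) (\<lambda>z. v (cnj z)) 0"
  have "cnj ` ?W = ?W" by (auto simp: image_iff) (metis complex_cnj_cnj complex_mod_cnj)
  then have vc: "C1_partials ?W (\<lambda>z. v (cnj z)) (\<lambda>z. vx (cnj z)) (\<lambda>z. - vy (cnj z))"
    using C1_partials_cnj[OF v] by simp
  have I: "I r = ?I1 r + ?I2 r" if "r > max 0 R0" for r
    unfolding I_def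
    by (rule ang_coeff_add[of _ ?W]) (use that in \<open>auto simp: norm_mult intro!: continuous_on_mode
        C1_partials_continuous(1)[OF v] C1_partials_continuous(1)[OF vc]\<close>)
  have d: "\<exists>D. (ang_coeff (mode k d) u 0 has_vector_derivative D) (at r)"
    if "r > max 0 R0" "C1_partials ?W u ux uy" for u ux uy :: "complex \<Rightarrow> complex" and r
    using ang_coeff_deriv[OF that(2), of "{max 0 R0<..}" r 0 "mode k d"] that(1)
    by (auto simp: norm_mult continuous_on_mode)
  have eq: "vector_derivative I (at r) = vector_derivative ?I1 (at r) + vector_derivative ?I2 (at r)"
    if r: "r > max 0 R0" for r
  proof -
    obtain D1 D2 where D: "(?I1 has_vector_derivative D1) (at r)" "(?I2 has_vector_derivative D2) (at r)"
      using d[OF r v] d[OF r vc] by blast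
    have "(I has_vector_derivative (D1 + D2)) (at r)"
      by (rule has_vector_derivative_transform_within_open[OF has_vector_derivative_add[OF D], of "{max 0 R0<..}"])
         (use r I in auto)
    then show ?thesis using D by (simp add: vector_derivative_at)
  qed
  have "((\<lambda>r. sqrt r *\<^sub>R (vector_derivative ?I1 (at r) - \<i> * of_real \<kappa> * ?I1 r)
      + sqrt r *\<^sub>R (vector_derivative ?I2 (at r) - \<i> * of_real \<kappa> * ?I2 r)) \<longlongrightarrow> 0 + 0) at_top"
    by (intro tendsto_add weak_radiation[OF v rad \<open>\<kappa> > 0\<close>]
        weak_radiation[OF vc radiating_cnj[OF v rad] \<open>\<kappa> > 0\<close>])
  moreover have "\<forall>\<^sub>F r in at_top. sqrt r *\<^sub>R (vector_derivative ?I1 (at r) - \<i> * of_real \<kappa> * ?I1 r)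
      + sqrt r *\<^sub>R (vector_derivative ?I2 (at r) - \<i> * of_real \<kappa> * ?I2 r)
      = sqrt r *\<^sub>R (vector_derivative I (at r) - \<i> * of_real \<kappa> * I r)"
    using eventually_gt_at_top[of "max 0 R0"]
    by eventually_elim (simp only: I eq scaleR_add_right[symmetric] distrib_left add_diff_add)
  ultimately show ?thesis by (simp add: Lim_transform_eventually)
qed

section \<open>Rellich's lemma for the symmetrised solution, and vanishing on a ray\<close>

lemma rellich_real_even:
  assumes \<kappa>: "\<kappa> > 0" and v: "helmholtz_on \<kappa> {z. cmod z > R} v" and rad: "radiating \<kappa> z0 v"
    and R: "R \<ge> 0" and real: "\<And>z. cmod z > R \<Longrightarrow> Im (v z + v (cnj z)) = 0" and z: "cmod z > R"
  shows "v z + v (cnj z) = 0"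
proof -
  let ?W = "{z. cmod z > R}" and ?w = "\<lambda>z. v z + v (cnj z)"
  obtain vx vy where C1: "C1_partials ?W v vx vy" using v unfolding helmholtz_on_def by blast
  have "cnj ` ?W = ?W" by (auto simp: image_iff) (metis complex_cnj_cnj complex_mod_cnj)
  then have w: "helmholtz_on \<kappa> ?W ?w"
    using helmholtz_on_add[OF v] helmholtz_on_cnj[OF v] by simp
  then obtain wx wy where wC1: "C1_partials ?W ?w wx wy" unfolding helmholtz_on_def by blast
  show ?thesis
  proof (rule helmholtz_modes_vanish[OF \<kappa> w, of "{R<..}" 0])
    fix k d
    let ?I = "ang_coeff (mode k d) ?w 0"
    let ?L = "\<lambda>r. sqrt r *\<^sub>R (vector_derivative ?I (at r) - \<i> * of_real \<kappa> * ?I r)"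
    have L: "(?L \<longlongrightarrow> 0) at_top" by (rule weak_radiation_even[OF C1 rad \<kappa>])
    have Im0: "Im (?I r) = 0" if "r > R" for r
    proof -
      have "(\<lambda>\<phi>. mode k d \<phi> *\<^sub>R ?w (0 + of_real r * cis \<phi>)) integrable_on {0..2*pi}"
        using that R by (intro ang_coeff_integrable[OF continuous_on_mode helmholtz_on_continuous[OF w]])
          (simp add: norm_mult)
      from integral_linear[OF this bounded_linear_Im]
      have "Im (?I r) = integral {0..2*pi} (\<lambda>\<phi>. mode k d \<phi> * Im (?w (0 + of_real r * cis \<phi>)))"
        by (simp add: ang_coeff_def o_def)
      also have "\<dots> = integral {0..2*pi} (\<lambda>\<phi>. 0)"
      proof (intro integral_cong)
        fix \<phi>
        have "Im (?w (0 + of_real r * cis \<phi>)) = 0"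
          by (rule real) (use that R in \<open>simp add: norm_mult\<close>)
        then show "mode k d \<phi> * Im (?w (0 + of_real r * cis \<phi>)) = 0" by (simp only: mult_zero_right)
      qed
      finally show ?thesis by simp
    qed
    have Im1: "Im (vector_derivative ?I (at r)) = 0" if r: "r > R" for r
    proof -
      obtain D where D: "(?I has_vector_derivative D) (at r)"
        using ang_coeff_deriv[OF wC1, of "{R<..}" r 0 "mode k d"] r R
        by (auto simp: norm_mult continuous_on_mode)
      have "((\<lambda>r. Im (?I r)) has_vector_derivative 0) (at r)"
        by (rule has_vector_derivative_transform_within_open[OF has_vector_derivative_const, of "{R<..}"])
           (use r Im0 in auto)
      with bounded_linear.has_vector_derivative[OF bounded_linear_Im D] have "Im D = 0"
        using vector_derivative_unique_at by blast
      then show ?thesis using vector_derivative_at[OF D] by simp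
    qed
    \<comment> \<open>As \<open>?I\<close> and its derivative are real, the real part of
      \<open>?L\<close> is \<open>sqrt r\<close> times the derivative and the imaginary part is
      \<open>- \<kappa> sqrt r ?I\<close>. The single complex limit therefore controls both
      ingredients of the energy at infinity.\<close>
    have "((\<lambda>r. of_real (Re (?L r)) :: complex) \<longlongrightarrow> of_real (Re 0)) at_top"
      by (intro tendsto_intros L)
    moreover have "\<forall>\<^sub>F r in at_top. of_real (Re (?L r)) = sqrt r *\<^sub>R vector_derivative ?I (at r)"
      using eventually_gt_at_top[of R]
      by eventually_elim (simp add: complex_eq_iff Im0 Im1)
    ultimately have 1: "((\<lambda>r. sqrt r *\<^sub>R vector_derivative ?I (at r)) \<longlongrightarrow> 0) at_top"
      by (simp add: Lim_transform_eventually)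
    have "((\<lambda>r. of_real (- Im (?L r) / \<kappa>) :: complex) \<longlongrightarrow> of_real (- Im 0 / \<kappa>)) at_top"
      using \<kappa> by (intro tendsto_intros L) auto
    moreover have "\<forall>\<^sub>F r in at_top. of_real (- Im (?L r) / \<kappa>) = sqrt r *\<^sub>R ?I r"
      using eventually_gt_at_top[of R]
      by eventually_elim (use \<kappa> in \<open>simp add: complex_eq_iff Im0 Im1\<close>)
    ultimately have 2: "((\<lambda>r. sqrt r *\<^sub>R ?I r) \<longlongrightarrow> 0) at_top"
      by (simp add: Lim_transform_eventually)
    show "(\<exists>S\<subseteq>{R<..}. open S \<and> S \<noteq> {} \<and> (\<forall>r\<in>S. ?I r = 0)) \<or>
       (\<exists>a. {R<..} = {a<..}) \<and> ((\<lambda>r. sqrt r *\<^sub>R ?I r) \<longlongrightarrow> 0) at_top \<and>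
        ((\<lambda>r. sqrt r *\<^sub>R vector_derivative ?I (at r)) \<longlongrightarrow> 0) at_top"
      using 1 2 by blast
  qed (use R z in auto)
qed

lemma radiating_zero_on_ray:
  assumes \<kappa>: "\<kappa> > 0" and v: "helmholtz_on \<kappa> V v" and rad: "radiating \<kappa> z0 v"
    and V: "{z. cmod z > R0} \<subseteq> V" and ray: "\<And>s. s > s1 \<Longrightarrow> of_real s \<in> V"
    and ab: "a < b" "\<And>s. a < s \<Longrightarrow> s < b \<Longrightarrow> s > s1 \<and> Im (v (of_real s)) = 0"
    and s: "s > s1"
  shows "v (of_real s) = 0"
proof -
  define w where "w z = v z + v (cnj z)" for z
  \<comment> \<open>The symmetric part of the domain, on which both summands of \<open>w\<close>
    solve the equation. It contains the ray, which reflection fixes pointwise, and the outside of a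
    disc.\<close>
  define N where "N = V \<inter> cnj ` V"
  define R where "R = max R0 0"
  let ?E = "{z. cmod z > R}" and ?L = "complex_of_real ` {s1<..}"
  have "open V" using v by (simp add: helmholtz_on_def)
  have cV: "open (cnj ` V)" using helmholtz_on_cnj[OF v] by (simp add: helmholtz_on_def)
  have "open N" unfolding N_def using \<open>open V\<close> cV by (rule open_Int)
  have wN: "helmholtz_on \<kappa> N w"
    unfolding w_def using \<open>open N\<close>
    by (intro helmholtz_on_add helmholtz_on_subset[OF v] helmholtz_on_subset[OF helmholtz_on_cnj[OF v]])
       (auto simp: N_def)
  define T where "T = ?L \<union> ?E"
  have EV: "?E \<subseteq> V" using V by (auto simp: R_def)
  have TN: "T \<subseteq> N"
  proof
    fix z assume "z \<in> T"
    then have "z \<in> V \<and> cnj z \<in> V" using EV ray by (auto simp: T_def)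
    then show "z \<in> N" unfolding N_def by (metis IntI complex_cnj_cnj imageI)
  qed
  have "connected T"
    unfolding T_def
  proof (rule connected_Un)
    show "connected ?L" by (intro connected_continuous_image continuous_intros) auto
    have "?E = - cball 0 R" by auto
    then show "connected ?E"
      using connected_complement_bounded_convex[of "cball (0::complex) R"] by simp
    define t where "t = max s1 R + 1"
    have "t > s1" "t > R" "R \<ge> 0" by (auto simp: t_def R_def)
    then have "of_real t \<in> ?L \<inter> ?E" by simp
    then show "?L \<inter> ?E \<noteq> {}" by blast
  qed
  \<comment> \<open>\<open>N\<close> may be disconnected. The ray and the outside of the disc
    overlap, so they lie in one component, and unique continuation is run inside it in both
    directions.\<close>
  define C where "C = connected_component_set N (of_real s)"
  have sT: "of_real s \<in> T" using s by (auto simp: T_def)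
  have C: "open C" "connected C" "T \<subseteq> C" "C \<subseteq> N"
    unfolding C_def using \<open>open N\<close> connected_component_maximal[OF sT \<open>connected T\<close> TN]
    by (auto intro: open_connected_component connected_component_subset[THEN subsetD])
  have wC: "helmholtz_on \<kappa> C w" by (rule helmholtz_on_subset[OF wN C(1,4)])
  have Im0: "Im (w z) = 0" if z: "z \<in> C" for z
  proof -
    define p :: complex where "p = of_real ((a + b) / 2)"
    have "(a + b) / 2 \<in> {s1<..}" using ab(1) ab(2)[of "(a+b)/2"] by simp
    then have "p \<in> T" unfolding T_def p_def by blast
    then have "p \<in> C" using C(3) by blast
    then obtain d0 where d0: "d0 > 0" "ball p d0 \<subseteq> C" using C(1) by (meson openE)
    \<comment> \<open>The second bound keeps the real points of the ball about the midpoint inside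
      the interval from \<open>a\<close> to \<open>b\<close>, where \<open>Im v\<close> is known to
      vanish.\<close>
    define d where "d = min d0 ((b - a) / 2)"
    have d: "d > 0" "ball p d \<subseteq> C" using d0 ab(1) by (auto simp: d_def)
    have "Im (w z) = 0" if "z \<in> ball p d" for z
    proof (rule even_cauchy_unique[OF \<kappa> helmholtz_on_linear[OF bounded_linear_Im helmholtz_on_subset[OF wC open_ball d(2)]] _ _ _ that])
      show "Im p = 0" by (simp add: p_def)
      show "Im (w (cnj z)) = Im (w z)" for z by (simp add: w_def)
      fix z assume z: "z \<in> ball p d" "Im z = 0"
      then have "\<bar>Re (p - z)\<bar> < d" using abs_Re_le_cmod[of "p - z"] by (simp add: dist_norm)
      then have "a < Re z" "Re z < b" by (auto simp: p_def d_def abs_less_iff field_simps)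
      then have "Im (v (of_real (Re z))) = 0" using ab(2) by blast
      moreover have "of_real (Re z) = z" "cnj z = z" using z(2) by (auto simp: complex_eq_iff)
      ultimately show "Im (w z) = 0" by (simp add: w_def)
    qed
    then show ?thesis
      using unique_continuation[OF \<kappa> helmholtz_on_linear[OF bounded_linear_Im wC] C(2) open_ball _ d(2) _ z] d(1)
      by simp
  qed
  have oE: "open ?E"
    by (intro open_Collect_less continuous_intros)
  have wE: "w z = 0" if "z \<in> ?E" for z
    unfolding w_def
    by (rule rellich_real_even[OF \<kappa> helmholtz_on_subset[OF v oE EV] rad])
       (use that Im0 C(3) in \<open>auto simp: R_def T_def w_def\<close>)
  have "of_real (R + 1) \<in> ?E"
  proof -
    have "R \<ge> 0" by (simp add: R_def)
    then show ?thesis by (simp del: of_real_add)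
  qed
  then have "?E \<noteq> {}" by blast
  then have "w (of_real s) = 0"
    by (rule unique_continuation[OF \<kappa> wC C(2) oE _ _ wE]) (use C(3) sT in \<open>auto simp: T_def\<close>)
  then show ?thesis by (simp add: w_def)
qed

subsection \<open>Passage to the plane\<close>

definition rot90 :: "real^2 \<Rightarrow> real^2" where
  "rot90 \<theta> = vector [- (\<theta> $ 2), \<theta> $ 1]"

text \<open>For a unit vector \<theta> this is an isometry taking \<open>of_real s\<close> to the
  point of the line with parameter \<open>s\<close>. Intervals of the line become real intervals and
  reflection in the line becomes \<open>cnj\<close>.\<close>

definition line_frame :: "real^2 \<Rightarrow> real^2 \<Rightarrow> complex \<Rightarrow> real^2" where
  "line_frame c \<theta> z = c + Re z *\<^sub>R \<theta> + Im z *\<^sub>R rot90 \<theta>"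

lemma rot90_nth [simp]: "rot90 \<theta> $ 1 = - (\<theta> $ 2)" "rot90 \<theta> $ 2 = \<theta> $ 1"
  by (simp_all add: rot90_def)

lemma norm_vec2: "(norm (x :: real^2))\<^sup>2 = (x $ 1)\<^sup>2 + (x $ 2)\<^sup>2"
  unfolding power2_norm_eq_inner inner_vec_def sum_2 by (simp add: power2_eq_square)

lemma norm_frame:
  assumes "norm \<theta> = 1"
  shows "norm (Re z *\<^sub>R \<theta> + Im z *\<^sub>R rot90 \<theta>) = cmod z"
proof -
  have "(\<theta> $ 1)\<^sup>2 + (\<theta> $ 2)\<^sup>2 = 1" using norm_vec2[of \<theta>] assms by simp
  moreover have "(norm (Re z *\<^sub>R \<theta> + Im z *\<^sub>R rot90 \<theta>))\<^sup>2 =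
      ((Re z)\<^sup>2 + (Im z)\<^sup>2) * ((\<theta> $ 1)\<^sup>2 + (\<theta> $ 2)\<^sup>2)"
    unfolding norm_vec2 vector_add_component vector_scaleR_component rot90_nth real_scaleR_def
    by algebra
  ultimately have "(norm (Re z *\<^sub>R \<theta> + Im z *\<^sub>R rot90 \<theta>))\<^sup>2 = (cmod z)\<^sup>2"
    by (simp add: cmod_power2)
  then show ?thesis by (simp add: power2_eq_iff_nonneg)
qed

text \<open>\<open>z0\<close> is the preimage of the origin of the plane; its coordinates are the
  components of \<open>- c\<close> in the orthonormal frame.\<close>

lemma line_frame_origin:
  assumes "norm \<theta> = 1"
  obtains z0 where "\<And>z. line_frame c \<theta> z = Re (z - z0) *\<^sub>R \<theta> + Im (z - z0) *\<^sub>R rot90 \<theta>"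
proof (rule that[of "Complex (- (c \<bullet> \<theta>)) (- (c \<bullet> rot90 \<theta>))"])
  fix z
  have "(\<theta> $ 1)\<^sup>2 + (\<theta> $ 2)\<^sup>2 = 1" using norm_vec2[of \<theta>] assms by simp
  then have "c $ 1 = (c \<bullet> \<theta>) * \<theta> $ 1 - (c \<bullet> rot90 \<theta>) * \<theta> $ 2"
    "c $ 2 = (c \<bullet> \<theta>) * \<theta> $ 2 + (c \<bullet> rot90 \<theta>) * \<theta> $ 1"
    unfolding inner_vec_def sum_2 inner_real_def rot90_nth by algebra+
  then have "c = (c \<bullet> \<theta>) *\<^sub>R \<theta> + (c \<bullet> rot90 \<theta>) *\<^sub>R rot90 \<theta>"
    by (simp add: vec_eq_iff forall_2)
  then show "line_frame c \<theta> z = Re (z - Complex (- (c \<bullet> \<theta>)) (- (c \<bullet> rot90 \<theta>))) *\<^sub>R \<theta>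
      + Im (z - Complex (- (c \<bullet> \<theta>)) (- (c \<bullet> rot90 \<theta>))) *\<^sub>R rot90 \<theta>"
    unfolding line_frame_def by (simp add: scaleR_add_left)
qed

lemma line_frame_continuous: "continuous_on A (line_frame c \<theta>)"
  unfolding line_frame_def[abs_def] by (intro continuous_intros)

lemma C1_partials_frame:
  assumes f: "C1_on U f"
  shows "C1_partials (line_frame c \<theta> -` U) (\<lambda>z. f (line_frame c \<theta> z))
    (\<lambda>z. (\<theta> $ 1) *\<^sub>R partial_deriv 1 f (line_frame c \<theta> z) + (\<theta> $ 2) *\<^sub>R partial_deriv 2 f (line_frame c \<theta> z))
    (\<lambda>z. - (\<theta> $ 2) *\<^sub>R partial_deriv 1 f (line_frame c \<theta> z) + (\<theta> $ 1) *\<^sub>R partial_deriv 2 f (line_frame c \<theta> z))"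
  unfolding C1_partials_def
proof (intro conjI ballI)
  let ?T = "line_frame c \<theta>"
  fix z assume z: "z \<in> ?T -` U"
  let ?D = "frechet_derivative f (at (?T z))"
  have D: "(f has_derivative ?D) (at (?T z))"
    using f z unfolding C1_on_def by (auto simp: frechet_derivative_works)
  then have L: "linear ?D" by (rule has_derivative_linear)
  have lin: "?D h = (h $ 1) *\<^sub>R partial_deriv 1 f (?T z) + (h $ 2) *\<^sub>R partial_deriv 2 f (?T z)" for h
  proof -
    have "h = (h $ 1) *\<^sub>R axis 1 1 + (h $ 2) *\<^sub>R axis 2 1"
      by (simp add: vec_eq_iff forall_2 axis_def)
    then have "?D h = ?D ((h $ 1) *\<^sub>R axis 1 1 + (h $ 2) *\<^sub>R axis 2 1)" by simp
    then show ?thesis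
      by (simp add: linear_add[OF L] linear_scale[OF L] partial_deriv_def)
  qed
  have "(?T has_derivative (\<lambda>h. Re h *\<^sub>R \<theta> + Im h *\<^sub>R rot90 \<theta>)) (at z)"
    unfolding line_frame_def[abs_def] by (auto intro!: derivative_eq_intros)
  from has_derivative_compose[OF this D]
  show "((\<lambda>z. f (?T z)) has_derivative lin2
    ((\<theta> $ 1) *\<^sub>R partial_deriv 1 f (?T z) + (\<theta> $ 2) *\<^sub>R partial_deriv 2 f (?T z))
    (- (\<theta> $ 2) *\<^sub>R partial_deriv 1 f (?T z) + (\<theta> $ 1) *\<^sub>R partial_deriv 2 f (?T z))) (at z)"
    by (rule has_derivative_eq_rhs) (simp add: fun_eq_iff lin lin2_def algebra_simps)
next
  let ?T = "line_frame c \<theta>"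
  have "continuous_on (?T -` U) (\<lambda>z. partial_deriv i f (?T z))" for i
    by (rule continuous_on_compose2[OF _ line_frame_continuous, of U])
       (use f in \<open>auto simp: C1_on_def\<close>)
  then show "continuous_on (?T -` U) (\<lambda>z. (\<theta> $ 1) *\<^sub>R partial_deriv 1 f (?T z) + (\<theta> $ 2) *\<^sub>R partial_deriv 2 f (?T z))"
    "continuous_on (?T -` U) (\<lambda>z. - (\<theta> $ 2) *\<^sub>R partial_deriv 1 f (?T z) + (\<theta> $ 1) *\<^sub>R partial_deriv 2 f (?T z))"
    by (intro continuous_intros; assumption)+
qed

text \<open>Rotation invariance of the Laplacian: in the sum of the two second derivatives the mixed
  terms cancel, and the pure ones acquire the factor \<open>|\<theta>|^2 = 1\<close>.\<close>

lemma helmholtz_on_frame: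
  assumes \<psi>: "radiation_solution \<kappa> U \<psi>" and "open U" and \<theta>: "norm \<theta> = 1"
  shows "helmholtz_on \<kappa> (line_frame c \<theta> -` U) (\<lambda>z. \<psi> (line_frame c \<theta> z))"
proof -
  let ?T = "line_frame c \<theta>"
  let ?P = "\<lambda>i z. partial_deriv i \<psi> (?T z)"
  let ?Q = "\<lambda>j i z. partial_deriv j (partial_deriv i \<psi>) (?T z)"
  have C2: "C1_on U \<psi>" "C1_on U (partial_deriv i \<psi>)" for i
    using \<psi> by (auto simp: radiation_solution_def C2_on_def)
  note P = C1_partials_frame[OF C2(2), of c \<theta>]
  have comb: "C1_partials (?T -` U) (\<lambda>z. a *\<^sub>R ?P 1 z + b *\<^sub>R ?P 2 z)
     (\<lambda>z. a *\<^sub>R ((\<theta> $ 1) *\<^sub>R ?Q 1 1 z + (\<theta> $ 2) *\<^sub>R ?Q 2 1 z) + b *\<^sub>R ((\<theta> $ 1) *\<^sub>R ?Q 1 2 z + (\<theta> $ 2) *\<^sub>R ?Q 2 2 z))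
     (\<lambda>z. a *\<^sub>R (- (\<theta> $ 2) *\<^sub>R ?Q 1 1 z + (\<theta> $ 1) *\<^sub>R ?Q 2 1 z) + b *\<^sub>R (- (\<theta> $ 2) *\<^sub>R ?Q 1 2 z + (\<theta> $ 1) *\<^sub>R ?Q 2 2 z))"
    for a b
    by (intro C1_partials_add C1_partials_linear[OF bounded_linear_scaleR_right] P)
  have "open (?T -` U)"
    by (rule open_vimage[OF \<open>open U\<close> line_frame_continuous])
  moreover have "((\<theta> $ 1) *\<^sub>R ((\<theta> $ 1) *\<^sub>R ?Q 1 1 z + (\<theta> $ 2) *\<^sub>R ?Q 2 1 z) + (\<theta> $ 2) *\<^sub>R ((\<theta> $ 1) *\<^sub>R ?Q 1 2 z + (\<theta> $ 2) *\<^sub>R ?Q 2 2 z))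
     + (- (\<theta> $ 2) *\<^sub>R (- (\<theta> $ 2) *\<^sub>R ?Q 1 1 z + (\<theta> $ 1) *\<^sub>R ?Q 2 1 z) + (\<theta> $ 1) *\<^sub>R (- (\<theta> $ 2) *\<^sub>R ?Q 1 2 z + (\<theta> $ 1) *\<^sub>R ?Q 2 2 z))
     + \<kappa>\<^sup>2 *\<^sub>R \<psi> (?T z) = 0" if "z \<in> ?T -` U" for z
  proof -
    have "?Q 1 1 z + ?Q 2 2 z + of_real (\<kappa>\<^sup>2) * \<psi> (?T z) = 0"
      using \<psi> that by (auto simp: radiation_solution_def laplacian_def sum_2)
    moreover have "of_real (\<theta> $ 1) * of_real (\<theta> $ 1) + of_real (\<theta> $ 2) * of_real (\<theta> $ 2) = (1 :: complex)"
      using norm_vec2[of \<theta>] \<theta> by (simp add: power2_eq_square flip: of_real_mult of_real_add)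
    ultimately show ?thesis
      unfolding scaleR_conv_of_real of_real_minus by algebra
  qed
  ultimately show ?thesis
    unfolding helmholtz_on_def
    using C1_partials_frame[OF C2(1), of c \<theta>] comb[of "\<theta> $ 1" "\<theta> $ 2"] comb[of "- (\<theta> $ 2)" "\<theta> $ 1"]
    by blast
qed

text \<open>Rays from the origin of the plane pull back to rays from \<open>z0\<close> with the same
  arc length. Since the complement of \<open>U\<close> is bounded, far points lie in
  \<open>U\<close>, where the chain rule identifies the derivative along the ray with the Frechet
  derivative in its direction.\<close>

lemma radiating_frame:
  assumes som: "sommerfeld_condition \<kappa> \<psi>" and C1: "C1_on U \<psi>" and bdd: "bounded (- U)"
    and z0: "\<And>z. line_frame c \<theta> z = Re (z - z0) *\<^sub>R \<theta> + Im (z - z0) *\<^sub>R rot90 \<theta>"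
    and \<theta>: "norm \<theta> = 1"
  shows "radiating \<kappa> z0 (\<lambda>z. \<psi> (line_frame c \<theta> z))"
  unfolding radiating_def
proof (intro allI impI)
  let ?T = "line_frame c \<theta>" and ?v = "\<lambda>z. \<psi> (line_frame c \<theta> z)"
  fix e :: real assume "e > 0"
  obtain B where B: "\<forall>x\<in>-U. norm x \<le> B"
    using bdd unfolding bounded_iff by blast
  from som[unfolded sommerfeld_condition_def, THEN uniform_limitD, OF \<open>e > 0\<close>]
  obtain R where "\<forall>r\<ge>R. \<forall>\<omega>\<in>sphere 0 1. dist (of_real (sqrt r) *
     (vector_derivative (\<lambda>s. \<psi> (s *\<^sub>R \<omega>)) (at r) - \<i> * of_real \<kappa> * \<psi> (r *\<^sub>R \<omega>))) 0 < e"
    unfolding eventually_at_top_linorder by blast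
  then have R: "cmod (of_real (sqrt r) *
     (vector_derivative (\<lambda>s. \<psi> (s *\<^sub>R \<omega>)) (at r) - \<i> * of_real \<kappa> * \<psi> (r *\<^sub>R \<omega>))) < e"
    if "r \<ge> R" "norm \<omega> = 1" for r \<omega>
    using that by (simp add: dist_norm del: norm_mult)
  show "\<exists>R. \<forall>z. cmod (z - z0) > R \<longrightarrow> sqrt (cmod (z - z0)) *
     cmod (frechet_derivative ?v (at z) (sgn (z - z0)) - \<i> * of_real \<kappa> * ?v z) \<le> e"
  proof (intro exI[of _ "max R (max B 0)"] allI impI)
    fix z assume z: "cmod (z - z0) > max R (max B 0)"
    define r where "r = cmod (z - z0)"
    define h where "h = sgn (z - z0)"
    define \<omega> where "\<omega> = Re h *\<^sub>R \<theta> + Im h *\<^sub>R rot90 \<theta>"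
    have r: "r > R" "r > B" "r > 0" using z by (auto simp: r_def)
    have "z - z0 \<noteq> 0" using r by (auto simp: r_def)
    then have h: "cmod h = 1" by (simp add: h_def norm_sgn)
    then have \<omega>: "norm \<omega> = 1" unfolding \<omega>_def by (simp add: norm_frame[OF \<theta>])
    have zr: "z = z0 + of_real r * h" using r(3) by (simp add: r_def h_def sgn_eq)
    have T: "?T (z0 + of_real s * h) = s *\<^sub>R \<omega>" for s
      unfolding z0 \<omega>_def by (simp add: scaleR_add_right)
    have "norm (?T z) = r" unfolding z0 norm_frame[OF \<theta>] r_def by (rule refl)
    then have zU: "z \<in> ?T -` U" using B r(2) by force
    note C = C1_partials_frame[OF C1, of c \<theta>]
    note D = C1_partials_derivative[OF C zU]
    have "((\<lambda>s. z0 + of_real s * h) has_vector_derivative h) (at r)"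
      by (auto intro!: derivative_eq_intros)
    from C1_partials_curve[OF C _ this] zU
    have "((\<lambda>s. \<psi> (s *\<^sub>R \<omega>)) has_vector_derivative frechet_derivative ?v (at z) h) (at r)"
      unfolding zr[symmetric] T frechet_derivative_at[OF D, symmetric] by blast
    then have "vector_derivative (\<lambda>s. \<psi> (s *\<^sub>R \<omega>)) (at r) = frechet_derivative ?v (at z) h"
      by (rule vector_derivative_at)
    moreover have "\<psi> (r *\<^sub>R \<omega>) = ?v z" using T[of r] zr by simp
    ultimately show "sqrt (cmod (z - z0)) *
       cmod (frechet_derivative ?v (at z) (sgn (z - z0)) - \<i> * of_real \<kappa> * ?v z) \<le> e"
      using R[of r \<omega>] r \<omega> by (simp add: norm_mult r_def[symmetric] h_def[symmetric])
  qed
qed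

lemma radiating_diff:
  assumes u: "C1_partials {z. cmod z > R0} u ux uy" and v: "C1_partials {z. cmod z > R0} v vx vy"
    and ru: "radiating \<kappa> z0 u" and rv: "radiating \<kappa> z0 v"
  shows "radiating \<kappa> z0 (\<lambda>z. u z - v z)"
  unfolding radiating_def
proof (intro allI impI)
  fix e :: real assume "e > 0"
  then have e: "e/2 > 0" by simp
  let ?d = "\<lambda>f z. frechet_derivative f (at z) (sgn (z - z0)) - \<i> * of_real \<kappa> * f z"
  obtain R1 where R1: "\<And>z. cmod (z - z0) > R1 \<Longrightarrow> sqrt (cmod (z - z0)) * cmod (?d u z) \<le> e/2"
    using ru[unfolded radiating_def, rule_format, OF e] by blast
  obtain R2 where R2: "\<And>z. cmod (z - z0) > R2 \<Longrightarrow> sqrt (cmod (z - z0)) * cmod (?d v z) \<le> e/2"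
    using rv[unfolded radiating_def, rule_format, OF e] by blast
  show "\<exists>R. \<forall>z. cmod (z - z0) > R \<longrightarrow> sqrt (cmod (z - z0)) * cmod (?d (\<lambda>z. u z - v z) z) \<le> e"
  proof (intro exI[of _ "max (max R1 R2) (R0 + cmod z0)"] allI impI)
    fix z assume z: "cmod (z - z0) > max (max R1 R2) (R0 + cmod z0)"
    then have "z \<in> {z. cmod z > R0}" using norm_triangle_ineq4[of z z0] by simp
    note D = C1_partials_derivative[OF u this] C1_partials_derivative[OF v this]
    have "?d (\<lambda>z. u z - v z) z = ?d u z - ?d v z"
      unfolding frechet_derivative_at[OF D(1), symmetric] frechet_derivative_at[OF D(2), symmetric]
        frechet_derivative_at[OF has_derivative_diff[OF D], symmetric]
      by (simp add: algebra_simps)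
    then have "sqrt (cmod (z - z0)) * cmod (?d (\<lambda>z. u z - v z) z)
       \<le> sqrt (cmod (z - z0)) * (cmod (?d u z) + cmod (?d v z))"
      by (intro mult_left_mono) (simp_all add: norm_triangle_ineq4)
    also have "\<dots> \<le> e/2 + e/2"
      unfolding distrib_left by (intro add_mono R1 R2) (use z in auto)
    finally show "sqrt (cmod (z - z0)) * cmod (?d (\<lambda>z. u z - v z) z) \<le> e" by simp
  qed
qed

text \<open>Half of the theorem: in line coordinates the difference of the two solutions falls under
  \<open>radiating_zero_on_ray\<close>, with a small symmetric interval about one parameter of
  \<Lambda> as the set where the imaginary part vanishes.\<close>

lemma ray_determined:
  assumes \<kappa>: "\<kappa> > 0" and U: "open U" "bounded (- U)" and \<theta>: "norm \<theta> = 1"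
    and x1: "x1 = c + s1 *\<^sub>R \<theta>" and ray: "ray_plus x1 \<theta> \<subseteq> U"
    and \<psi>: "radiation_solution \<kappa> U \<psi>1" "radiation_solution \<kappa> U \<psi>2"
    and \<Lambda>: "open_interval_of_line c \<theta> \<Lambda>" "\<Lambda> \<noteq> {}" "\<Lambda> \<subseteq> ray_plus x1 \<theta>"
    and Im: "\<And>x. x \<in> \<Lambda> \<Longrightarrow> Im (\<psi>1 x) = Im (\<psi>2 x)"
    and x: "x \<in> ray_plus x1 \<theta>"
  shows "\<psi>1 x = \<psi>2 x"
proof -
  let ?T = "line_frame c \<theta>"
  let ?v = "\<lambda>z. \<psi>1 (?T z) - \<psi>2 (?T z)"
  obtain z0 where z0: "\<And>z. ?T z = Re (z - z0) *\<^sub>R \<theta> + Im (z - z0) *\<^sub>R rot90 \<theta>"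
    using line_frame_origin[OF \<theta>] by blast
  obtain B where B: "\<forall>x\<in>-U. norm x \<le> B"
    using U(2) unfolding bounded_iff by blast
  have far: "{z. cmod z > B + cmod z0} \<subseteq> ?T -` U"
  proof
    fix z assume "z \<in> {z. cmod z > B + cmod z0}"
    then have "cmod (z - z0) > B" using norm_triangle_ineq2[of z z0] by simp
    then have "norm (?T z) > B" unfolding z0 norm_frame[OF \<theta>] .
    then show "z \<in> ?T -` U" using B by force
  qed
  have "bounded_linear (\<lambda>x::complex. - x)" by (intro bounded_linear_minus bounded_linear_ident)
  from helmholtz_on_add[OF helmholtz_on_frame[OF \<psi>(1) U(1) \<theta>, of c]
      helmholtz_on_linear[OF this helmholtz_on_frame[OF \<psi>(2) U(1) \<theta>, of c]]]
  have helm: "helmholtz_on \<kappa> (?T -` U) ?v" by simp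
  have rad: "radiating \<kappa> z0 ?v"
    using \<psi> U(2) z0 \<theta> unfolding radiation_solution_def C2_on_def
    by (intro radiating_diff[OF C1_partials_subset[OF C1_partials_frame far] C1_partials_subset[OF C1_partials_frame far]]
        radiating_frame[of _ _ U]) auto
  have real: "?T (of_real s) = c + s *\<^sub>R \<theta>" for s by (simp add: line_frame_def)
  have "\<theta> \<noteq> 0" using \<theta> by auto
  then have inray: "c + s *\<^sub>R \<theta> \<in> ray_plus x1 \<theta> \<longleftrightarrow> s > s1" for s
    unfolding ray_plus_def x1
    by (auto simp: add.assoc simp flip: scaleR_add_left intro: exI[of _ "s - s1"])
  obtain I where I: "open I" "\<Lambda> = (\<lambda>s. c + s *\<^sub>R \<theta>) ` I"
    using \<Lambda>(1) unfolding open_interval_of_line_def by blast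
  then obtain s0 where "s0 \<in> I" using \<Lambda>(2) by blast
  then obtain e where e: "e > 0" "ball s0 e \<subseteq> I" using I(1) by (meson openE)
  obtain s where s: "s > s1" "x = c + s *\<^sub>R \<theta>"
    using x inray unfolding ray_plus_def x1 by (auto simp: add.assoc simp flip: scaleR_add_left)
  have "?v (of_real s) = 0"
  proof (rule radiating_zero_on_ray[OF \<kappa> helm rad far _ _ _ s(1)])
    show "of_real t \<in> ?T -` U" if "t > s1" for t
      using ray inray that by (auto simp: real)
    show "s0 - e < s0 + e" using e(1) by simp
    fix t assume "s0 - e < t" "t < s0 + e"
    then have "t \<in> I" using e(2) by (auto simp: dist_real_def abs_less_iff)
    then have "c + t *\<^sub>R \<theta> \<in> \<Lambda>" using I(2) by blast
    then show "t > s1 \<and> Im (?v (of_real t)) = 0"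
      using \<Lambda>(3) inray Im by (auto simp: real)
  qed
  then show ?thesis by (simp add: real s(2))
qed

text \<open>Reversing the direction turns \<open>ray_minus\<close> into \<open>ray_plus\<close>, so
  \<open>ray_determined\<close> serves both rays.\<close>

lemma open_interval_of_line_reverse:
  assumes "open_interval_of_line c \<theta> \<Lambda>"
  shows "open_interval_of_line c (- \<theta>) \<Lambda>"
proof -
  obtain I where I: "open I" "is_interval I" "\<Lambda> = (\<lambda>s. c + s *\<^sub>R \<theta>) ` I"
    using assms unfolding open_interval_of_line_def by blast
  have "\<Lambda> = (\<lambda>s. c + s *\<^sub>R - \<theta>) ` uminus ` I" by (simp add: I(3) image_image)
  moreover have "open (uminus ` I)" "is_interval (uminus ` I)"
    using I(1,2) by (simp_all add: open_negations)
  ultimately show ?thesis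
    unfolding open_interval_of_line_def by blast
qed

lemma exterior_region_cobounded: "exterior_region U \<Longrightarrow> bounded (- U)"
  unfolding exterior_region_def using cobounded_outside by blast

theorem theorem1:
  fixes \<kappa> :: real and U :: "(real^2) set"
    and x0 x1 x2 \<theta> :: "real^2"
    and \<Lambda>p \<Lambda>m :: "(real^2) set"
    and \<psi>1 \<psi>2 :: "real^2 \<Rightarrow> complex"
  assumes "\<kappa> > 0"
    and "exterior_region U"
    and "\<theta> \<in> sphere 0 1"
    and "x1 \<in> straight_line x0 \<theta>"
    and "x2 \<in> straight_line x0 \<theta>"
    and "ray_plus x1 \<theta> \<subseteq> U"
    and "ray_minus x2 \<theta> \<subseteq> U"
    and "open_interval_of_line x0 \<theta> \<Lambda>p" and "\<Lambda>p \<noteq> {}" and "\<Lambda>p \<subseteq> ray_plus x1 \<theta>"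
    and "open_interval_of_line x0 \<theta> \<Lambda>m" and "\<Lambda>m \<noteq> {}" and "\<Lambda>m \<subseteq> ray_minus x2 \<theta>"
    and "radiation_solution \<kappa> U \<psi>1"
    and "radiation_solution \<kappa> U \<psi>2"
    and "\<forall>x \<in> \<Lambda>p \<union> \<Lambda>m. Im (\<psi>1 x) = Im (\<psi>2 x)"
  shows "\<forall>x \<in> ray_plus x1 \<theta> \<union> ray_minus x2 \<theta>. \<psi>1 x = \<psi>2 x"
proof
  fix x assume "x \<in> ray_plus x1 \<theta> \<union> ray_minus x2 \<theta>"
  have minus: "ray_minus x2 \<theta> = ray_plus x2 (- \<theta>)" by (simp add: ray_minus_def ray_plus_def)
  have U: "open U" "bounded (- U)"
    using assms(2) exterior_region_cobounded by (auto simp: exterior_region_def)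
  \<comment> \<open>Along the reversed direction \<open>- \<theta>\<close> the point
    \<open>x2\<close> has parameter \<open>- s2\<close>, the form that \<open>ray_determined\<close>
    expects.\<close>
  obtain s1 s2 where s: "x1 = x0 + s1 *\<^sub>R \<theta>" "x2 = x0 + (- s2) *\<^sub>R (- \<theta>)"
    using assms(4,5) by (auto simp: straight_line_def)
  have \<theta>: "norm \<theta> = 1" "norm (- \<theta>) = 1" using assms(3) by auto
  from \<open>x \<in> ray_plus x1 \<theta> \<union> ray_minus x2 \<theta>\<close> show "\<psi>1 x = \<psi>2 x"
  proof
    assume "x \<in> ray_plus x1 \<theta>"
    then show ?thesis
      using ray_determined[OF assms(1) U \<theta>(1) s(1) assms(6,14,15,8-10)] assms(16) by blast
  next
    assume "x \<in> ray_minus x2 \<theta>"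
    then show ?thesis
      using ray_determined[OF assms(1) U \<theta>(2) s(2) assms(7)[unfolded minus] assms(14,15)
          open_interval_of_line_reverse[OF assms(11)] assms(12) assms(13)[unfolded minus]] assms(16)
      unfolding minus by blast
  qed
qed

end
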